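(* Let $M\subset\mathbb{R}^m$ be a compact subset and let $F\colon\Sigma_k\times M\to\Sigma_k\times M$, $F(\vartheta,x)=(\sigma(\vartheta),f_{\vartheta_0}(x))$, be a step skew product with continuous fiber maps $f_1,\dots,f_k\colon M\to M$ over an irreducible Markov shift $(\Sigma_k,\mathscr{F},\mathbb{P},\sigma)$. Suppose that $F$ splits. Let $P=(p_{ij})$ be the corresponding transition matrix and suppose that there is $u$ such that $p_{uj}>0$ for every $j$. Then: (1) The coding map $\rho$ is defined $\mathbb{P}$-almost everywhere, i.e. $\mathbb{P}(S_F)=1$. (2) There are $\lambda\in(0,1)$ and $N\ge0$ such that for every probability measure $\mu\in\mathcal{M}_{\mathbb{P}}(\Sigma_k\times M)$ we have $$d_W(F_*^n\mu,\hat\rho_*\mathbb{P})\le m\,\lambda^n\quad\text{for every } n\ge N.$$ (3) There are $q\in(0,1)$ and $N\ge0$ such that for $\mathbb{P}$-almost every $\vartheta\in\Sigma_k$ there is $C(\vartheta)>0$ such that $$d(F^n(\vartheta,x),\hat\rho(\sigma^n(\vartheta)))\le C(\vartheta)\,q^n\quad\text{for every } n\ge N\text{ and every }x\in M.$$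
   Context: $\Sigma_k=\{1,\dots,k\}^{\mathbb{Z}}$ with the product topology and metric $d_0(\vartheta,\xi)=2^{-n}$, $n=\min\{|i|:\vartheta_i\ne\xi_i\}$ for $\vartheta\neq\xi$; $\sigma$ is the (left) shift and $\mathscr{F}$ the product $\sigma$-algebra. On $\mathbb{R}^m$ use $d_1(x,y)=\sum_{i=1}^m|x_i-y_i|$, and on $\Sigma_k\times M$ use $d((\vartheta,x),(\xi,y))=d_0(\vartheta,\xi)+d_1(x,y)$. A transition matrix $P=(p_{ij})$ is a $k\times k$ matrix with nonnegative entries and rows summing to $1$. A stationary probability vector $\bar p$ is a probability vector with $\bar pP=\bar p$. The Markov measure $\mathbb{P}$ associated to $(P,\bar p)$ is the unique ($\sigma$-invariant) probability measure on $\Sigma_k$ for which the coordinate maps form a homogeneous Markov chain with transition matrix $P$ and starting vector $\bar p$; $(\Sigma_k,\mathscr{F},\mathbb{P},\sigma)$ is then a Markov shift. It is irreducible if for all $\ell,r\in\{1,\dots,k\}$ there is $n$ with $(P^n)_{\ell r}>0$ (then $\bar p$ is unique and positive). A finite sequence $(a_1\dots a_\ell)\in\{1,\dots,k\}^\ell$ is $\mathbb{P}$-admissible if $p_{a_ia_{i+1}}>0$ for $i=1,\dots,\ell-1$. Write $f_\vartheta^n=f_{\vartheta_{n-1}}\circ\cdots\circ f_{\vartheta_0}$ and $\pi_s(x_1,\dots,x_m)=x_s$. $F$ splits if there are $\mathbb{P}$-admissible sequences $(a_1\dots a_\ell)$ and $(b_1\dots b_r)$ with $a_\ell=b_r$ such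 that the sets $M_1=f_{a_\ell}\circ\cdots\circ f_{a_1}(M)$ and $M_2=f_{b_r}\circ\cdots\circ f_{b_1}(M)$ satisfy $\pi_s(f_\vartheta^n(M_1))\cap\pi_s(f_\vartheta^n(M_2))=\emptyset$ for every $\vartheta\in\Sigma_k$, every $n\ge0$ and every $s\in\{1,\dots,m\}$. $S_F=\{\vartheta:\bigcap_{n\ge0}f_{\vartheta_{-1}}\circ\cdots\circ f_{\vartheta_{-n}}(M)\text{ is a singleton}\}$; the coding map is $\rho\colon S_F\to M$, $\rho(\vartheta)=\lim_{n}f_{\vartheta_{-1}}\circ\cdots\circ f_{\vartheta_{-n}}(p)$ (independent of $p\in M$); and $\hat\rho(\vartheta)=(\vartheta,\rho(\vartheta))$. $\mathcal{M}_{\mathbb{P}}(\Sigma_k\times M)$ is the set of Borel probability measures on $\Sigma_k\times M$ whose push-forward under $(\vartheta,x)\mapsto\vartheta$ is $\mathbb{P}$. $F_*\nu(A)=\nu(F^{-1}(A))$. The Wasserstein metric is $d_W(\mu,\nu)=\sup\{|\int\phi\,d\mu-\int\phi\,d\nu|:\phi\in\mathrm{Lip}_1(\Sigma_k\times M)\}$, where $\mathrm{Lip}_1$ is the set of real functions on $\Sigma_k\times M$ that are Lipschitz with constant one with respect to $d$.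
   Formalization: M is additionally assumed connected (and non-empty); for disconnected compact M the claim fails, e.g. M=[0,1]∪[10,11] with f_i(x+10e)=(x+2(i-1))/3+10e (i=1,2; e=0,1) and all p_ij=1/2: F splits but S_F is empty. *)

theory Defs
  imports "HOL-Probability.Probability"
begin

definition Seqs :: "nat \<Rightarrow> (int \<Rightarrow> nat) set" where
  "Seqs k = {\<theta>. \<forall>i. \<theta> i \<in> {1..k}}"

(* The product sigma-algebra; its space is Seqs k. *)
definition seq_algebra :: "nat \<Rightarrow> (int \<Rightarrow> nat) measure" where
  "seq_algebra k = (\<Pi>\<^sub>M i\<in>UNIV. count_space {1..k})"

definition shift :: "(int \<Rightarrow> nat) \<Rightarrow> int \<Rightarrow> nat" where
  "shift \<theta> = (\<lambda>i. \<theta> (i + 1))"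

definition d0 :: "(int \<Rightarrow> nat) \<Rightarrow> (int \<Rightarrow> nat) \<Rightarrow> real" where
  "d0 \<theta> \<xi> = (if \<theta> = \<xi> then 0
     else (1 / 2) ^ (LEAST n. \<exists>i. n = nat \<bar>i\<bar> \<and> \<theta> i \<noteq> \<xi> i))"

definition d1 :: "real ^ 'm \<Rightarrow> real ^ 'm \<Rightarrow> real" where
  "d1 x y = (\<Sum>s\<in>UNIV. \<bar>x $ s - y $ s\<bar>)"

definition dprod :: "(int \<Rightarrow> nat) \<times> (real ^ 'm) \<Rightarrow> (int \<Rightarrow> nat) \<times> (real ^ 'm) \<Rightarrow> real" where
  "dprod z w = d0 (fst z) (fst w) + d1 (snd z) (snd w)"

(* The Borel sets of Seqs k \<times> M. The ambient topology on (int \<Rightarrow> nat) \<times> real ^ 'm is the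
   product topology with nat discrete, and its trace on Seqs k \<times> M is the topology of dprod. *)
definition total_algebra ::
  "nat \<Rightarrow> (real ^ 'm) set \<Rightarrow> ((int \<Rightarrow> nat) \<times> (real ^ 'm)) measure" where
  "total_algebra k M = restrict_space borel (Seqs k \<times> M)"

(* k \<times> k matrices and vectors are functions of which only the entries with indices
   in {1..k} are used. *)
definition transition_matrix :: "nat \<Rightarrow> (nat \<Rightarrow> nat \<Rightarrow> real) \<Rightarrow> bool" where
  "transition_matrix k P \<longleftrightarrow>
     (\<forall>i\<in>{1..k}. (\<forall>j\<in>{1..k}. 0 \<le> P i j) \<and> (\<Sum>j=1..k. P i j) = 1)"

definition stationary_vector :: "nat \<Rightarrow> (nat \<Rightarrow> nat \<Rightarrow> real) \<Rightarrow> (nat \<Rightarrow> real) \<Rightarrow> bool" where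
  "stationary_vector k P p \<longleftrightarrow>
     (\<forall>i\<in>{1..k}. 0 \<le> p i) \<and> (\<Sum>i=1..k. p i) = 1 \<and>
     (\<forall>j\<in>{1..k}. (\<Sum>i=1..k. p i * P i j) = p j)"

primrec matrix_power :: "nat \<Rightarrow> (nat \<Rightarrow> nat \<Rightarrow> real) \<Rightarrow> nat \<Rightarrow> nat \<Rightarrow> nat \<Rightarrow> real" where
  "matrix_power k P 0 = (\<lambda>i j. if i = j then 1 else 0)"
| "matrix_power k P (Suc n) = (\<lambda>i j. \<Sum>l=1..k. matrix_power k P n i l * P l j)"

definition irreducible_matrix :: "nat \<Rightarrow> (nat \<Rightarrow> nat \<Rightarrow> real) \<Rightarrow> bool" where
  "irreducible_matrix k P \<longleftrightarrow> (\<forall>l\<in>{1..k}. \<forall>r\<in>{1..k}. \<exists>n. 0 < matrix_power k P n l r)"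

(* The Markov property is required for pasts of every finite length starting at any time s. *)
definition markov_measure ::
  "nat \<Rightarrow> (nat \<Rightarrow> nat \<Rightarrow> real) \<Rightarrow> (nat \<Rightarrow> real) \<Rightarrow> (int \<Rightarrow> nat) measure \<Rightarrow> bool" where
  "markov_measure k P p \<PP> \<longleftrightarrow>
     prob_space \<PP> \<and> sets \<PP> = sets (seq_algebra k) \<and>
     distr \<PP> (seq_algebra k) shift = \<PP> \<and>
     (\<forall>a\<in>{1..k}. \<P>(\<theta> in \<PP>. \<theta> 0 = a) = p a) \<and>
     (\<forall>(s::int) (n::nat) (a::nat \<Rightarrow> nat). \<forall>j\<in>{1..k}.
        0 < \<P>(\<theta> in \<PP>. \<forall>i\<le>n. \<theta> (s + int i) = a i) \<longrightarrow>
        \<P>(\<theta> in \<PP>. \<theta> (s + int n + 1) = j \<bar> \<forall>i\<le>n. \<theta> (s + int i) = a i) = P (a n) j)"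

definition admissible :: "nat \<Rightarrow> (nat \<Rightarrow> nat \<Rightarrow> real) \<Rightarrow> nat list \<Rightarrow> bool" where
  "admissible k P as \<longleftrightarrow> as \<noteq> [] \<and> set as \<subseteq> {1..k} \<and>
     (\<forall>i. Suc i < length as \<longrightarrow> 0 < P (as ! i) (as ! Suc i))"

definition skew :: "(nat \<Rightarrow> real ^ 'm \<Rightarrow> real ^ 'm) \<Rightarrow>
    (int \<Rightarrow> nat) \<times> (real ^ 'm) \<Rightarrow> (int \<Rightarrow> nat) \<times> (real ^ 'm)" where
  "skew f z = (shift (fst z), f (fst z 0) (snd z))"

primrec fwd :: "(nat \<Rightarrow> real ^ 'm \<Rightarrow> real ^ 'm) \<Rightarrow> (int \<Rightarrow> nat) \<Rightarrow> nat \<Rightarrow> real ^ 'm \<Rightarrow> real ^ 'm" where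
  "fwd f \<theta> 0 = id"
| "fwd f \<theta> (Suc n) = f (\<theta> (int n)) \<circ> fwd f \<theta> n"

primrec bwd :: "(nat \<Rightarrow> real ^ 'm \<Rightarrow> real ^ 'm) \<Rightarrow> (int \<Rightarrow> nat) \<Rightarrow> nat \<Rightarrow> real ^ 'm \<Rightarrow> real ^ 'm" where
  "bwd f \<theta> 0 = id"
| "bwd f \<theta> (Suc n) = bwd f \<theta> n \<circ> f (\<theta> (- int (Suc n)))"

(* fold f [a1, ..., al] is f al \<circ> ... \<circ> f a1.
   For disconnected M this condition does not force any contraction. Take m = 1, k = 2, all P i j = 1/2,
   M = [0,1] \<union> [10,11] and f i (x + 10 * e) = (x + 2 * (i - 1)) / 3 + 10 * e
   for i in {1,2}, x in [0,1], e in {0,1}: these maps are injective with disjoint images,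
   so the words [1,1] and [2,1] split, yet both components are invariant. *)
definition splits :: "nat \<Rightarrow> (nat \<Rightarrow> nat \<Rightarrow> real) \<Rightarrow> (real ^ 'm) set \<Rightarrow>
    (nat \<Rightarrow> real ^ 'm \<Rightarrow> real ^ 'm) \<Rightarrow> bool" where
  "splits k P M f \<longleftrightarrow>
     (\<exists>as bs. admissible k P as \<and> admissible k P bs \<and> last as = last bs \<and>
        (\<forall>\<theta>\<in>Seqs k. \<forall>n s.
           (\<lambda>x. x $ s) ` fwd f \<theta> n ` fold f as ` M \<inter>
           (\<lambda>x. x $ s) ` fwd f \<theta> n ` fold f bs ` M = {}))"

definition S_F :: "nat \<Rightarrow> (real ^ 'm) set \<Rightarrow> (nat \<Rightarrow> real ^ 'm \<Rightarrow> real ^ 'm) \<Rightarrow> (int \<Rightarrow> nat) set" where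
  "S_F k M f = {\<theta> \<in> Seqs k. is_singleton (\<Inter>n. bwd f \<theta> n ` M)}"

(* Meaningful only for \<theta> in S_F k M f. *)
definition coding :: "(real ^ 'm) set \<Rightarrow> (nat \<Rightarrow> real ^ 'm \<Rightarrow> real ^ 'm) \<Rightarrow>
    (int \<Rightarrow> nat) \<Rightarrow> real ^ 'm" where
  "coding M f \<theta> = (THE y. \<forall>p\<in>M. (\<lambda>n. bwd f \<theta> n p) \<longlonglongrightarrow> y)"

definition coding_hat :: "(real ^ 'm) set \<Rightarrow> (nat \<Rightarrow> real ^ 'm \<Rightarrow> real ^ 'm) \<Rightarrow>
    (int \<Rightarrow> nat) \<Rightarrow> (int \<Rightarrow> nat) \<times> (real ^ 'm)" where
  "coding_hat M f \<theta> = (\<theta>, coding M f \<theta>)"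

(* coding_hat is only defined on S_F k M f, so its push-forward assigns to A the
   probability of the set of all \<theta> in S_F k M f with coding_hat M f \<theta> in A. *)
definition coding_push :: "nat \<Rightarrow> (real ^ 'm) set \<Rightarrow> (nat \<Rightarrow> real ^ 'm \<Rightarrow> real ^ 'm) \<Rightarrow>
    (int \<Rightarrow> nat) measure \<Rightarrow> ((int \<Rightarrow> nat) \<times> (real ^ 'm)) measure" where
  "coding_push k M f \<PP> =
     distr (restrict_space \<PP> (S_F k M f)) (total_algebra k M) (coding_hat M f)"

definition skew_push :: "nat \<Rightarrow> (real ^ 'm) set \<Rightarrow> (nat \<Rightarrow> real ^ 'm \<Rightarrow> real ^ 'm) \<Rightarrow>
    ((int \<Rightarrow> nat) \<times> (real ^ 'm)) measure \<Rightarrow> ((int \<Rightarrow> nat) \<times> (real ^ 'm)) measure" where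
  "skew_push k M f \<nu> = distr \<nu> (total_algebra k M) (skew f)"

definition measures_over :: "nat \<Rightarrow> (real ^ 'm) set \<Rightarrow> (int \<Rightarrow> nat) measure \<Rightarrow>
    ((int \<Rightarrow> nat) \<times> (real ^ 'm)) measure set" where
  "measures_over k M \<PP> =
     {\<mu>. prob_space \<mu> \<and> sets \<mu> = sets (total_algebra k M) \<and>
          distr \<mu> (seq_algebra k) fst = \<PP>}"

definition Lip1 :: "nat \<Rightarrow> (real ^ 'm) set \<Rightarrow> ((int \<Rightarrow> nat) \<times> (real ^ 'm) \<Rightarrow> real) set" where
  "Lip1 k M = {\<phi>. \<forall>z\<in>Seqs k \<times> M. \<forall>w\<in>Seqs k \<times> M. \<bar>\<phi> z - \<phi> w\<bar> \<le> dprod z w}"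

(* For bounded M and probability measures on total_algebra k M the supremum is over a
   bounded set, so it is a genuine real supremum. *)
definition wasserstein :: "nat \<Rightarrow> (real ^ 'm) set \<Rightarrow> ((int \<Rightarrow> nat) \<times> (real ^ 'm)) measure \<Rightarrow>
    ((int \<Rightarrow> nat) \<times> (real ^ 'm)) measure \<Rightarrow> real" where
  "wasserstein k M \<mu> \<nu> =
     (SUP \<phi>\<in>Lip1 k M. \<bar>integral\<^sup>L \<mu> \<phi> - integral\<^sup>L \<nu> \<phi>\<bar>)"

end

theory Submission
  imports Defs
begin

text \<open>Reading a bi-infinite sequence backwards from time $0$ gives longer and longer pasts
$w = \vartheta_{-n} \dots \vartheta_{-1}$, and the images $f_w(M)$ decrease with $n$. Everything
follows once their size is known to be exponentially small in mean. The size of $f_w(M)$ is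
measured by its \<open>width\<close>, the sum over the coordinates $s$ of the lengths of the intervals
$I_s(w) = \pi_s(f_w(M))$; that these sets are intervals is where the connectedness of $M$ enters.

The mean width is computed by exchanging two integrations: the mean length of $I_s(w)$ is the integral over
$x \in \mathbb{R}$ of the probability that $x \in I_s(w)$ (\<open>expected_proj_length\<close>), so it is
enough to bound the latter probability uniformly in $x$. The two splitting words end in the same symbol.
Following them by a common path to $u$ and preceding them by powers of $u$, which is possible since
$u$ may be followed by every symbol, turns them into words $A$ and $B$ of the same length $L$
that may be put in front of every word $w$, with conditional probability bounded below
(\<open>splitting_blocks\<close>). For each $w$ the intervals $I_s(Aw)$ and $I_s(Bw)$ are disjoint, so
one of them misses $x$. Hence looking $L$ further steps into the past multiplies the
probability that $x$ is still covered by at most $1 - \delta$ (\<open>covering_weight_contracts\<close>),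
and the mean width is at most $C \lambda^n$ for some $\lambda < 1$.

The three claims are consequences. By the Borel--Cantelli lemma the width of the image along the past is
almost surely eventually at most $\lambda^{n/2}$; by compactness, vanishing widths mean that the
intersection of the images is a point, which gives the first claim. The
fiber part of $F^n(\vartheta, x)$ and the point $\rho(\sigma^n \vartheta)$ both lie in the image
of $M$ along the $n$-step past of $\sigma^n \vartheta$. The Borel--Cantelli argument
for these pasts gives the third claim, and for a measure with marginal $\mathbb{P}$ integration of
the same distance bounds the Wasserstein distance by the mean width, which is the second claim.\<close>

section \<open>Words and the fiber maps along them\<close>

text \<open>The word $\vartheta_{-n} \dots \vartheta_{-1}$, in chronological order, so that
  \<open>fold f (past \<theta> n)\<close> is the backward iterate.\<close>

primrec past :: "(int \<Rightarrow> nat) \<Rightarrow> nat \<Rightarrow> nat list" where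
  "past \<theta> 0 = []"
| "past \<theta> (Suc n) = \<theta> (- int (Suc n)) # past \<theta> n"

definition words :: "nat \<Rightarrow> nat \<Rightarrow> nat list set" where
  "words k n = {w. length w = n \<and> set w \<subseteq> {1..k}}"

text \<open>The probability of following a word, given its first letter.\<close>

fun path_weight :: "(nat \<Rightarrow> nat \<Rightarrow> real) \<Rightarrow> nat list \<Rightarrow> real" where
  "path_weight P (a # b # w) = P a b * path_weight P (b # w)"
| "path_weight P w = 1"

text \<open>The probability that a stretch of the stationary chain spells the word
  \<open>w\<close>.\<close>

definition cyl_weight :: "(nat \<Rightarrow> nat \<Rightarrow> real) \<Rightarrow> (nat \<Rightarrow> real) \<Rightarrow> nat list \<Rightarrow> real" where
  "cyl_weight P p w = (if w = [] then 1 else p (hd w) * path_weight P w)"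

lemma length_past [simp]: "length (past \<theta> n) = n"
  by (induction n) auto

lemma nth_past: "i < n \<Longrightarrow> past \<theta> n ! i = \<theta> (int i - int n)"
  by (induction n arbitrary: i) (auto simp: nth_Cons split: nat.splits)

lemma past_in_words: "\<theta> \<in> Seqs k \<Longrightarrow> past \<theta> n \<in> words k n"
  by (induction n) (auto simp: words_def Seqs_def)

lemma bwd_eq_fold: "bwd f \<theta> n = fold f (past \<theta> n)"
  by (induction n) auto

lemma fwd_eq_fold: "fwd f \<theta> n = fold f (map (\<lambda>i. \<theta> (int i)) [0..<n])"
  by (induction n) auto

lemma funpow_shift: "(shift ^^ n) \<theta> = (\<lambda>i. \<theta> (i + int n))"
  by (induction n) (auto simp: shift_def algebra_simps)

text \<open>The bridge between the two kinds of iterates: forward iteration along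
  \<open>\<theta>\<close> for time \<open>n\<close> reads the same symbols as backward iteration
  along the shifted sequence. By shift invariance of the measure, all estimates on pasts transfer
  to forward orbits.\<close>

lemma fwd_eq_bwd_shift: "fwd f \<theta> n = bwd f ((shift ^^ n) \<theta>) n"
proof -
  have "map (\<lambda>i. \<theta> (int i)) [0..<n] = past ((shift ^^ n) \<theta>) n"
    by (rule nth_equalityI) (auto simp: nth_past funpow_shift)
  then show ?thesis by (simp add: bwd_eq_fold fwd_eq_fold)
qed

lemma funpow_skew: "(skew f ^^ n) (\<theta>, x) = ((shift ^^ n) \<theta>, fwd f \<theta> n x)"
proof (induction n)
  case (Suc n)
  have "(skew f ^^ Suc n) (\<theta>, x) = skew f ((skew f ^^ n) (\<theta>, x))" by simp
  also have "\<dots> = ((shift ^^ Suc n) \<theta>, fwd f \<theta> (Suc n) x)"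
    unfolding Suc by (simp add: skew_def) (simp add: funpow_shift)
  finally show ?case .
qed simp

lemma finite_words [simp]: "finite (words k n)"
  unfolding words_def using finite_lists_length_eq[of "{1..k}" n] by (simp add: conj_commute)

lemma words_0 [simp]: "words k 0 = {[]}"
  by (auto simp: words_def)

lemma sum_words_append:
  fixes g :: "nat list \<Rightarrow> real"
  shows "(\<Sum>u\<in>words k (l + n). g u) = (\<Sum>w\<in>words k n. \<Sum>v\<in>words k l. g (v @ w))"
proof -
  have "(\<Sum>w\<in>words k n. \<Sum>v\<in>words k l. g (v @ w))
      = (\<Sum>(w, v)\<in>words k n \<times> words k l. g (v @ w))"
    by (rule sum.cartesian_product)
  also have "\<dots> = (\<Sum>u\<in>words k (l + n). g u)"
    by (rule sum.reindex_bij_witness[of _ "\<lambda>u. (drop l u, take l u)" "\<lambda>(w, v). v @ w"])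
      (auto simp: words_def dest: in_set_takeD in_set_dropD)
  finally show ?thesis by simp
qed

lemma sum_words_Suc:
  fixes g :: "nat list \<Rightarrow> real"
  shows "(\<Sum>u\<in>words k (Suc n). g u) = (\<Sum>w\<in>words k n. \<Sum>a=1..k. g (a # w))"
proof -
  have "(\<Sum>v\<in>words k 1. g (v @ w)) = (\<Sum>a=1..k. g (a # w))" for w
    by (rule sum.reindex_bij_witness[of _ "\<lambda>a. [a]" hd])
      (auto simp: words_def length_Suc_conv)
  then show ?thesis using sum_words_append[of g k 1 n] by simp
qed

lemma path_weight_append:
  assumes "v \<noteq> []" "w \<noteq> []"
  shows "path_weight P (v @ w) = path_weight P v * P (last v) (hd w) * path_weight P w"
  using assms
proof (induction P v rule: path_weight.induct)
  case ("2_2" P a)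
  then show ?case by (cases w) auto
qed auto

lemma path_weight_eq_prod:
  "path_weight P w = (\<Prod>i<length w - 1. P (w ! i) (w ! Suc i))"
proof (induction P w rule: path_weight.induct)
  case (1 P a b w)
  then show ?case by (simp add: prod.lessThan_Suc_shift del: prod.lessThan_Suc)
qed auto

lemma admissible_path_weight_pos: "admissible k P w \<Longrightarrow> 0 < path_weight P w"
  unfolding path_weight_eq_prod admissible_def by (intro prod_pos) auto

lemma past_eq_iff:
  assumes "length w = Suc n"
  shows "past \<theta> (Suc n) = w \<longleftrightarrow> (\<forall>i\<le>n. \<theta> (- int (Suc n) + int i) = w ! i)"
  using assms nth_past[of _ "Suc n" \<theta>]
  by (simp add: list_eq_iff_nth_eq less_Suc_eq_le algebra_simps del: past.simps)

section \<open>Stationary chains\<close>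

locale stationary_chain =
  fixes k :: nat and P :: "nat \<Rightarrow> nat \<Rightarrow> real" and p :: "nat \<Rightarrow> real"
  assumes transition: "transition_matrix k P"
    and stationary: "stationary_vector k P p"
begin

lemma P_nonneg: "i \<in> {1..k} \<Longrightarrow> j \<in> {1..k} \<Longrightarrow> 0 \<le> P i j"
  and p_nonneg: "i \<in> {1..k} \<Longrightarrow> 0 \<le> p i"
  and p_sum: "(\<Sum>i=1..k. p i) = 1"
  and p_inv: "j \<in> {1..k} \<Longrightarrow> (\<Sum>i=1..k. p i * P i j) = p j"
  using transition stationary by (auto simp: transition_matrix_def stationary_vector_def)

lemma P_le_1: assumes "i \<in> {1..k}" "j \<in> {1..k}" shows "P i j \<le> 1"
proof -
  have "P i j \<le> (\<Sum>j=1..k. P i j)"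
    using assms by (intro member_le_sum) (auto intro: P_nonneg)
  then show ?thesis using assms transition by (simp add: transition_matrix_def)
qed

lemma p_le_1: assumes "i \<in> {1..k}" shows "p i \<le> 1"
  using member_le_sum[of i "{1..k}" p] assms p_sum p_nonneg by auto

lemma path_weight_bounds: "set w \<subseteq> {1..k} \<Longrightarrow> 0 \<le> path_weight P w \<and> path_weight P w \<le> 1"
  unfolding path_weight_eq_prod
  by (auto intro!: prod_nonneg prod_le_1 P_nonneg P_le_1 simp: subset_iff)

lemma cyl_weight_nonneg: "w \<in> words k n \<Longrightarrow> 0 \<le> cyl_weight P p w"
  using path_weight_bounds[of w] p_nonneg[of "hd w"]
  by (auto simp: cyl_weight_def words_def subset_iff)

text \<open>This is where stationarity is used: the chain extends consistently into the
  past.\<close>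

lemma sum_cyl_weight_Cons:
  assumes "w \<in> words k n"
  shows "(\<Sum>a=1..k. cyl_weight P p (a # w)) = cyl_weight P p w"
proof (cases w)
  case Nil
  then show ?thesis using p_sum by (simp add: cyl_weight_def)
next
  case (Cons b w')
  then have b: "b \<in> {1..k}" using assms by (auto simp: words_def)
  have "(\<Sum>a=1..k. cyl_weight P p (a # w)) = (\<Sum>a=1..k. p a * P a b) * path_weight P w"
    by (simp add: Cons cyl_weight_def sum_distrib_right mult.assoc)
  then show ?thesis using p_inv[OF b] by (simp add: Cons cyl_weight_def)
qed

lemma sum_cyl_weight_prefix:
  assumes "w \<in> words k n"
  shows "(\<Sum>v\<in>words k l. cyl_weight P p (v @ w)) = cyl_weight P p w"
proof (induction l)
  case (Suc l)
  have "(\<Sum>v\<in>words k (Suc l). cyl_weight P p (v @ w))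
      = (\<Sum>v\<in>words k l. \<Sum>a=1..k. cyl_weight P p (a # v @ w))"
    using sum_words_Suc[where g = "\<lambda>v. cyl_weight P p (v @ w)"] by simp
  also have "\<dots> = (\<Sum>v\<in>words k l. cyl_weight P p (v @ w))"
  proof (rule sum.cong[OF refl])
    fix v assume "v \<in> words k l"
    then have "v @ w \<in> words k (l + n)" using assms by (auto simp: words_def)
    then show "(\<Sum>a=1..k. cyl_weight P p (a # v @ w)) = cyl_weight P p (v @ w)"
      by (rule sum_cyl_weight_Cons)
  qed
  finally show ?case using Suc by simp
qed simp

lemma sum_cyl_weight: "(\<Sum>v\<in>words k l. cyl_weight P p v) = 1"
  using sum_cyl_weight_prefix[of "[]" 0 l] by (simp add: cyl_weight_def)

lemma matrix_power_nonneg: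
  "i \<in> {1..k} \<Longrightarrow> j \<in> {1..k} \<Longrightarrow> 0 \<le> matrix_power k P n i j"
  by (induction n arbitrary: j) (auto intro!: sum_nonneg mult_nonneg_nonneg P_nonneg)

lemma matrix_power_inv:
  "j \<in> {1..k} \<Longrightarrow> (\<Sum>i=1..k. p i * matrix_power k P n i j) = p j"
proof (induction n arbitrary: j)
  case 0
  have "(\<Sum>i=1..k. p i * matrix_power k P 0 i j) = (\<Sum>i=1..k. if i = j then p i else 0)"
    by (intro sum.cong) auto
  then show ?case using 0 by simp
next
  case (Suc n)
  have "(\<Sum>i=1..k. p i * matrix_power k P (Suc n) i j)
      = (\<Sum>i=1..k. \<Sum>l=1..k. p i * matrix_power k P n i l * P l j)"
    by (simp add: sum_distrib_left mult.assoc)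
  also have "\<dots> = (\<Sum>l=1..k. (\<Sum>i=1..k. p i * matrix_power k P n i l) * P l j)"
    by (subst sum.swap) (simp add: sum_distrib_right)
  also have "\<dots> = p j" using Suc by (simp add: p_inv del: One_nat_def)
  finally show ?case .
qed

lemma path_of_matrix_power_pos:
  assumes "i \<in> {1..k}" "j \<in> {1..k}" "0 < matrix_power k P n i j"
  shows "\<exists>v. set v \<subseteq> {1..k} \<and> 0 < path_weight P (i # v) \<and> last (i # v) = j"
  using assms
proof (induction n arbitrary: j)
  case 0
  then show ?case by (intro exI[of _ "[]"]) (auto split: if_splits)
next
  case (Suc n)
  then have "(\<Sum>l=1..k. matrix_power k P n i l * P l j) \<noteq> 0" by simp
  then obtain l where l: "l \<in> {1..k}" "matrix_power k P n i l * P l j \<noteq> 0"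
    by (meson sum.neutral)
  then have "0 < matrix_power k P n i l" "0 < P l j"
    using matrix_power_nonneg[of i l n] P_nonneg[of l j] Suc.prems by (auto simp: less_le)
  with Suc.IH l Suc.prems obtain v
    where v: "set v \<subseteq> {1..k}" "0 < path_weight P (i # v)" "last (i # v) = l" by blast
  have "path_weight P ((i # v) @ [j]) = path_weight P (i # v) * P l j"
    using path_weight_append[of "i # v" "[j]" P] v by simp
  with v \<open>0 < P l j\<close> Suc.prems show ?case
    by (intro exI[of _ "v @ [j]"]) auto
qed

text \<open>Stationarity propagates to all powers of the matrix, so some symbol of positive weight
  passes weight on to every symbol that it can reach.\<close>

lemma p_pos:
  assumes "irreducible_matrix k P" and j: "j \<in> {1..k}"
  shows "0 < p j"
proof -
  obtain i where i: "i \<in> {1..k}" "p i \<noteq> 0"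
    using p_sum by (metis sum.neutral zero_neq_one)
  obtain n where n: "0 < matrix_power k P n i j"
    using assms i by (meson irreducible_matrix_def)
  have "0 < p i * matrix_power k P n i j"
    using i n p_nonneg[of i] by auto
  also have "\<dots> \<le> (\<Sum>i=1..k. p i * matrix_power k P n i j)"
    using i j by (intro member_le_sum) (auto intro!: mult_nonneg_nonneg p_nonneg matrix_power_nonneg)
  finally show ?thesis using matrix_power_inv[OF j] by simp
qed

lemma k_pos: "1 \<le> k"
  using p_sum by (cases k) auto

end

section \<open>Images of the fiber along words\<close>

locale fiber_maps =
  fixes k :: nat and M :: "(real ^ 'm) set" and f :: "nat \<Rightarrow> real ^ 'm \<Rightarrow> real ^ 'm"
  assumes compact_M: "compact M" and M_nonempty: "M \<noteq> {}" and connected_M: "connected M"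
    and maps: "\<forall>i\<in>{1..k}. continuous_on M (f i) \<and> f i ` M \<subseteq> M"
begin

definition proj :: "'m \<Rightarrow> nat list \<Rightarrow> real set" where
  "proj s w = (\<lambda>x. x $ s) ` fold f w ` M"

definition width :: "nat list \<Rightarrow> real" where
  "width w = (\<Sum>s\<in>UNIV. measure lborel (proj s w))"

lemma fold_maps:
  "set w \<subseteq> {1..k} \<Longrightarrow> continuous_on M (fold f w) \<and> fold f w ` M \<subseteq> M"
proof (induction w)
  case (Cons a w)
  then have a: "continuous_on M (f a)" "f a ` M \<subseteq> M" using maps by auto
  from Cons have w: "continuous_on M (fold f w)" "fold f w ` M \<subseteq> M" by auto
  from a w have "continuous_on M (fold f w \<circ> f a)"
    by (blast intro: continuous_on_compose continuous_on_subset)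
  moreover from a w have "(fold f w \<circ> f a) ` M \<subseteq> M" by auto
  ultimately show ?case by simp
qed (auto simp: id_def)

lemma fold_append_image: "fold f (v @ w) ` A = fold f w ` fold f v ` A"
  by (simp add: image_comp)

lemma fold_append_subset:
  "set v \<subseteq> {1..k} \<Longrightarrow> fold f (v @ w) ` M \<subseteq> fold f w ` M"
  using fold_maps[of v] by (auto simp: image_subset_iff)

lemma proj_append_subset: "set v \<subseteq> {1..k} \<Longrightarrow> proj s (v @ w) \<subseteq> proj s w"
  unfolding proj_def by (intro image_mono fold_append_subset)

lemma compact_fold: "set w \<subseteq> {1..k} \<Longrightarrow> compact (fold f w ` M)"
  using fold_maps compact_M by (blast intro: compact_continuous_image)

lemma proj_interval: "set w \<subseteq> {1..k} \<Longrightarrow> \<exists>a b. a \<le> b \<and> proj s w = {a..b}"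
proof -
  assume w: "set w \<subseteq> {1..k}"
  have "compact (proj s w)" unfolding proj_def
    by (intro compact_continuous_image compact_fold w continuous_intros)
  moreover have "connected (proj s w)" unfolding proj_def
    using fold_maps[OF w] connected_M
    by (intro connected_continuous_image continuous_intros) auto
  moreover have "proj s w \<noteq> {}" using M_nonempty by (simp add: proj_def)
  ultimately show ?thesis
    using connected_compact_interval_1[of "proj s w"] by force
qed

lemma dist_le_measure_proj:
  assumes "set w \<subseteq> {1..k}" "x \<in> proj s w" "y \<in> proj s w"
  shows "\<bar>x - y\<bar> \<le> measure lborel (proj s w)"
proof -
  obtain a b where "a \<le> b" "proj s w = {a..b}" using proj_interval assms by blast
  then show ?thesis using assms by auto
qed

text \<open>The width bounds the diameter of the image because both points have their coordinates
  in the projections, which are intervals.\<close>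

lemma d1_le_width:
  assumes "set w \<subseteq> {1..k}" "x \<in> fold f w ` M" "y \<in> fold f w ` M"
  shows "d1 x y \<le> width w"
  unfolding d1_def width_def using assms
  by (intro sum_mono dist_le_measure_proj) (auto simp: proj_def)

lemma measure_proj_le:
  assumes "set w \<subseteq> {1..k}" "proj s w \<subseteq> {a..b}" "a \<le> b"
  shows "measure lborel (proj s w) \<le> b - a"
proof -
  obtain c d where "c \<le> d" "proj s w = {c..d}" using proj_interval assms by blast
  then show ?thesis using assms by auto
qed

lemma width_nonneg: "0 \<le> width w"
  unfolding width_def by (intro sum_nonneg) auto

text \<open>For the cylinder weights \<open>c\<close>, this is the probability that the
  \<open>s\<close>-th projection along a random word of length \<open>n\<close> contains
  \<open>x\<close>.\<close>

definition covering_weight :: "(nat list \<Rightarrow> real) \<Rightarrow> 'm \<Rightarrow> nat \<Rightarrow> real \<Rightarrow> real" where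
  "covering_weight c s n x = (\<Sum>w\<in>words k n. c w * indicator (proj s w) x)"

text \<open>The length of an interval is the integral of its indicator; exchanging this integral
  with the finite sum over words turns a uniform bound on covering probabilities into a bound on
  the mean length. The integral extends only over the projection of \<open>M\<close>, which
  contains all the others.\<close>

lemma expected_proj_length:
  assumes "\<And>x. covering_weight c s n x \<le> B" and c: "\<And>w. w \<in> words k n \<Longrightarrow> 0 \<le> c w"
  shows "(\<Sum>w\<in>words k n. c w * measure lborel (proj s w)) \<le> B * measure lborel (proj s [])"
proof -
  have int: "integrable lborel (indicator (proj s w) :: real \<Rightarrow> real)" if w: "set w \<subseteq> {1..k}" for w
  proof -
    obtain a b where ab: "a \<le> b" "proj s w = {a..b}" using proj_interval w by blast
    show ?thesis unfolding ab(2) using ab(1) by (simp add: integrable_indicator_iff)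
  qed
  have "(\<Sum>w\<in>words k n. c w * measure lborel (proj s w)) = (LINT x|lborel. covering_weight c s n x)"
    unfolding covering_weight_def
    by (subst Bochner_Integration.integral_sum)
       (auto simp: words_def intro!: int sum.cong integrable_mult_right)
  also have "\<dots> \<le> (LINT x|lborel. B * indicator (proj s []) x)"
  proof (rule integral_mono)
    show "integrable lborel (covering_weight c s n)" unfolding covering_weight_def
      by (intro Bochner_Integration.integrable_sum integrable_mult_right int) (auto simp: words_def)
    show "integrable lborel (\<lambda>x. B * indicator (proj s []) x)"
      by (intro integrable_mult_right int) auto
    show "covering_weight c s n x \<le> B * indicator (proj s []) x" for x
    proof (cases "x \<in> proj s []")
      case True
      then show ?thesis using assms by simp
    next
      case False
      then have "x \<notin> proj s w" if "w \<in> words k n" for w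
        using proj_append_subset[of w s "[]"] that by (auto simp: words_def)
      then show ?thesis using False by (simp add: covering_weight_def)
    qed
  qed
  also have "\<dots> = B * measure lborel (proj s [])" by simp
  finally show ?thesis .
qed

lemma expected_width_le:
  assumes "\<And>s x. covering_weight c s n x \<le> B" and c: "\<And>w. w \<in> words k n \<Longrightarrow> 0 \<le> c w"
  shows "(\<Sum>w\<in>words k n. c w * width w) \<le> B * width []"
  unfolding width_def sum_distrib_left
  by (subst sum.swap) (intro sum_mono expected_proj_length assms)

end

section \<open>Splitting words and decay of the mean width\<close>

locale split_chain = stationary_chain k P p + fiber_maps k M f
  for k P p and M :: "(real ^ 'm) set" and f +
  fixes u :: nat
  assumes irreducible: "irreducible_matrix k P"
    and splitting: "splits k P M f"
    and u: "u \<in> {1..k}" "\<forall>j\<in>{1..k}. 0 < P u j"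
begin

lemma path_weight_Cons_u:
  assumes "w \<noteq> []" "set w \<subseteq> {1..k}"
  shows "path_weight P (u # w) = P u (hd w) * path_weight P w"
  using path_weight_append[of "[u]" w] assms by simp

lemma path_weight_replicate_u_pos:
  assumes "w \<noteq> []" "set w \<subseteq> {1..k}" "0 < path_weight P w"
  shows "0 < path_weight P (replicate n u @ w)"
proof (induction n)
  case (Suc n)
  have "hd w \<in> {1..k}" using assms hd_in_set by blast
  then have "hd (replicate n u @ w) \<in> {1..k}" using u by (cases n) auto
  moreover have "set (replicate n u @ w) \<subseteq> {1..k}" using assms u by auto
  ultimately show ?case using Suc assms u path_weight_Cons_u[of "replicate n u @ w"] by simp
qed (simp add: assms)

text \<open>Splitting is a condition on all infinite sequences; a finite word is continued by
  \<open>u\<close> to such a sequence.\<close>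

lemma disjoint_fold:
  assumes "\<forall>\<theta>\<in>Seqs k. \<forall>n s.
           (\<lambda>x. x $ s) ` fwd f \<theta> n ` X \<inter> (\<lambda>x. x $ s) ` fwd f \<theta> n ` Y = {}"
    and w: "set w \<subseteq> {1..k}"
  shows "(\<lambda>x. x $ s) ` fold f w ` X \<inter> (\<lambda>x. x $ s) ` fold f w ` Y = {}"
proof -
  define \<theta> where "\<theta> = (\<lambda>i::int. if nat i < length w then w ! nat i else u)"
  have "\<theta> \<in> Seqs k" using w u by (auto simp: Seqs_def \<theta>_def subset_iff)
  moreover have "map (\<lambda>i. \<theta> (int i)) [0..<length w] = w"
    by (rule nth_equalityI) (auto simp: \<theta>_def)
  ultimately show ?thesis
    using assms(1)[rule_format, of \<theta> s "length w"] by (simp add: fwd_eq_fold)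
qed

text \<open>The splitting words \<open>as\<close> and \<open>bs\<close> become blocks that can be
  inserted before any word. A common path \<open>v\<close> from their last letter to
  \<open>u\<close> makes the blocks end in \<open>u\<close>, from which every letter can follow.
  Preceding \<open>as\<close> by as many letters \<open>u\<close> as \<open>bs\<close> has
  letters, and conversely, makes the lengths equal. Letters in front only shrink images, and
  letters behind are covered by the definition of splitting, so the disjointness survives.\<close>

lemma splitting_blocks:
  obtains A B L where
    "A \<in> words k L" "B \<in> words k L" "0 < L"
    "hd A = u" "hd B = u" "last A = u" "last B = u"
    "0 < path_weight P A" "0 < path_weight P B"
    "\<And>s w. set w \<subseteq> {1..k} \<Longrightarrow> proj s (A @ w) \<inter> proj s (B @ w) = {}"
proof -
  obtain as bs where ab: "admissible k P as" "admissible k P bs" "last as = last bs"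
    and dis: "\<forall>\<theta>\<in>Seqs k. \<forall>n s.
           (\<lambda>x. x $ s) ` fwd f \<theta> n ` fold f as ` M \<inter>
           (\<lambda>x. x $ s) ` fwd f \<theta> n ` fold f bs ` M = {}"
    using splitting unfolding splits_def by blast
  have as: "as \<noteq> []" "set as \<subseteq> {1..k}" and bs: "bs \<noteq> []" "set bs \<subseteq> {1..k}"
    using ab by (auto simp: admissible_def)
  have "last as \<in> {1..k}" using as by (meson last_in_set subsetD)
  then obtain n where "0 < matrix_power k P n (last as) u"
    using irreducible u by (meson irreducible_matrix_def)
  then obtain v where v: "set v \<subseteq> {1..k}" "0 < path_weight P (last as # v)" "last (last as # v) = u"
    using path_of_matrix_power_pos \<open>last as \<in> {1..k}\<close> u by blast
  have v_ext: "0 < path_weight P (xs @ v)" "last (xs @ v) = u"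
    if "xs \<noteq> []" "0 < path_weight P xs" "last xs = last as" for xs
  proof -
    show "last (xs @ v) = u" using v that by auto
    show "0 < path_weight P (xs @ v)"
    proof (cases "v = []")
      case False
      have "path_weight P (last as # v) = P (last as) (hd v) * path_weight P v"
        using path_weight_append[of "[last as]" v P] False by simp
      then show ?thesis using v that False path_weight_append[of xs v P]
        by (simp add: mult.assoc)
    qed (use that in simp)
  qed
  define A where "A = replicate (length bs) u @ as @ v"
  define B where "B = replicate (length as) u @ bs @ v"
  show ?thesis
  proof (rule that[of A "length as + length bs + length v" B])
    show "A \<in> words k (length as + length bs + length v)"
      "B \<in> words k (length as + length bs + length v)"
      using as bs v u by (auto simp: words_def A_def B_def)
    show "0 < length as + length bs + length v" using as by simp
    show "hd A = u" "hd B = u" using as bs by (auto simp: A_def B_def hd_append)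
    show "last A = u" "last B = u" using as bs v_ext(2)[of as] v_ext(2)[of bs] v_ext ab
      admissible_path_weight_pos[OF ab(1)] admissible_path_weight_pos[OF ab(2)]
      by (auto simp: A_def B_def)
    show "0 < path_weight P A" "0 < path_weight P B" unfolding A_def B_def
      using as bs v ab(3) admissible_path_weight_pos[OF ab(1)] admissible_path_weight_pos[OF ab(2)]
      by (intro path_weight_replicate_u_pos v_ext(1); simp)+
    fix s :: 'm and w :: "nat list" assume w: "set w \<subseteq> {1..k}"
    have sub: "proj s (replicate n u @ xs @ v @ w)
        \<subseteq> (\<lambda>x. x $ s) ` fold f (v @ w) ` fold f xs ` M" if "set xs \<subseteq> {1..k}" for n xs
    proof -
      have "set (replicate n u) \<subseteq> {1..k}" using u by auto
      from proj_append_subset[OF this, of s "xs @ v @ w"] show ?thesis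
        by (simp add: proj_def fold_append_image[symmetric] del: fold_append)
    qed
    have disj: "(\<lambda>x. x $ s) ` fold f (v @ w) ` fold f as ` M \<inter>
        (\<lambda>x. x $ s) ` fold f (v @ w) ` fold f bs ` M = {}"
      using v w by (intro disjoint_fold dis) auto
    have "proj s (A @ w) \<inter> proj s (B @ w)
        \<subseteq> (\<lambda>x. x $ s) ` fold f (v @ w) ` fold f as ` M \<inter>
          (\<lambda>x. x $ s) ` fold f (v @ w) ` fold f bs ` M"
      unfolding A_def B_def append_assoc by (intro Int_mono sub as bs)
    then show "proj s (A @ w) \<inter> proj s (B @ w) = {}"
      unfolding disj by (simp only: subset_empty)
  qed
qed

text \<open>A lower bound, independent of \<open>w\<close>, for the conditional probability that
  the block \<open>A\<close> precedes \<open>w\<close>. The first letter of \<open>w\<close> loses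
  its stationary weight \<open>p (hd w)\<close>, which is at most one, and gains the transition
  probability from \<open>u\<close>.\<close>

lemma cyl_weight_block:
  assumes A: "A \<in> words k L" "A \<noteq> []" "hd A = u" "last A = u" and w: "w \<in> words k n"
    and d: "\<And>j. j \<in> {1..k} \<Longrightarrow> d \<le> P u j" "0 \<le> d" "d \<le> 1"
  shows "p u * d * path_weight P A * cyl_weight P p w \<le> cyl_weight P p (A @ w)"
proof -
  have A0: "0 \<le> path_weight P A" using A path_weight_bounds by (auto simp: words_def)
  have pu: "0 \<le> p u" using u p_nonneg by blast
  show ?thesis
  proof (cases "w = []")
    case True
    have "p u * path_weight P A * d \<le> p u * path_weight P A * 1"
      using A0 pu d by (intro mult_left_mono) auto
    then show ?thesis using A True by (simp add: cyl_weight_def mult_ac)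
  next
    case False
    then have h: "hd w \<in> {1..k}" using w by (auto simp: words_def subset_iff)
    have w0: "0 \<le> path_weight P w" using w path_weight_bounds by (auto simp: words_def)
    have "d * p (hd w) \<le> P u (hd w) * 1"
      using h d p_le_1 p_nonneg by (intro mult_mono) (auto intro: order_trans)
    then have "p u * path_weight P A * path_weight P w * (d * p (hd w))
        \<le> p u * path_weight P A * path_weight P w * (P u (hd w) * 1)"
      using A0 w0 pu by (intro mult_left_mono) auto
    then show ?thesis using A False path_weight_append[of A w P]
      by (simp add: cyl_weight_def mult_ac)
  qed
qed

lemma covering_weight_le_1: "covering_weight (cyl_weight P p) s n x \<le> 1"
proof -
  have "covering_weight (cyl_weight P p) s n x \<le> (\<Sum>w\<in>words k n. cyl_weight P p w)"
    unfolding covering_weight_def by (intro sum_mono) (auto simp: cyl_weight_nonneg indicator_def)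
  then show ?thesis by (simp add: sum_cyl_weight)
qed

text \<open>Fix a word \<open>w\<close> whose projection covers \<open>x\<close>. Among its
  extensions by \<open>L\<close> letters into the past, at least one of \<open>A @ w\<close> and
  \<open>B @ w\<close> no longer covers \<open>x\<close>, and it carries at least a fraction
  \<open>\<delta>\<close> of the weight of \<open>w\<close>.\<close>

lemma covering_weight_contracts:
  obtains L \<delta> where "0 < L" "0 < \<delta>" "\<delta> < 1"
    "\<And>s n x. covering_weight (cyl_weight P p) s (L + n) x \<le> (1 - \<delta>) * covering_weight (cyl_weight P p) s n x"
proof (rule splitting_blocks)
  fix A B L
  assume AB: "A \<in> words k L" "B \<in> words k L" "0 < L"
    "hd A = u" "hd B = u" "last A = u" "last B = u"
    "0 < path_weight P A" "0 < path_weight P B"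
    and dis: "\<And>s w. set w \<subseteq> {1..k} \<Longrightarrow> proj s (A @ w) \<inter> proj s (B @ w) = {}"
  have ne: "A \<noteq> []" "B \<noteq> []" using AB by (auto simp: words_def)
  define d where "d = Min (P u ` {1..k})"
  have d: "d \<le> P u j" if "j \<in> {1..k}" for j unfolding d_def using that by auto
  have "d \<in> P u ` {1..k}" unfolding d_def using k_pos by (intro Min_in) auto
  then have d01: "0 < d" "d \<le> 1" using u P_le_1 by auto
  have pu: "0 < p u" using p_pos irreducible u by blast
  \<comment> \<open>The cap 1/2 keeps the contraction factor positive, so that its root of order L is a rate in the open unit interval.\<close>
  define \<delta> where "\<delta> = min (1/2) (p u * d * min (path_weight P A) (path_weight P B))"
  have \<delta>01: "0 < \<delta>" "\<delta> < 1" using pu d01 AB by (auto simp: \<delta>_def)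
  have block: "\<delta> * cyl_weight P p w \<le> cyl_weight P p (A @ w)"
      "\<delta> * cyl_weight P p w \<le> cyl_weight P p (B @ w)" if w: "w \<in> words k n" for w n
  proof -
    have "\<delta> \<le> p u * d * path_weight P A" "\<delta> \<le> p u * d * path_weight P B"
      unfolding \<delta>_def using pu d01 by (auto intro!: min.coboundedI2)
    then show "\<delta> * cyl_weight P p w \<le> cyl_weight P p (A @ w)"
      "\<delta> * cyl_weight P p w \<le> cyl_weight P p (B @ w)"
      using cyl_weight_block[OF AB(1) ne(1) AB(4,6) w d] cyl_weight_block[OF AB(2) ne(2) AB(5,7) w d]
        cyl_weight_nonneg[OF w] d01 by (meson mult_right_mono order_trans less_imp_le)+
  qed
  have "covering_weight (cyl_weight P p) s (L + n) x \<le> (1 - \<delta>) * covering_weight (cyl_weight P p) s n x" for s n x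
  proof -
    have "(\<Sum>v\<in>words k L. cyl_weight P p (v @ w) * indicator (proj s (v @ w)) x)
        \<le> (1 - \<delta>) * (cyl_weight P p w * indicator (proj s w) x)" (is "?lhs \<le> _")
      if w: "w \<in> words k n" for w
    proof (cases "x \<in> proj s w")
      case False
      then have "x \<notin> proj s (v @ w)" if "v \<in> words k L" for v
        using proj_append_subset[of v s w] that by (auto simp: words_def)
      then show ?thesis using False by simp
    next
      case True
      obtain C where C: "C = A \<or> C = B" "x \<notin> proj s (C @ w)"
        using dis[of w s] w by (auto simp: words_def)
      then have CL: "C \<in> words k L" using AB by auto
      have nn: "0 \<le> cyl_weight P p (v @ w)" if "v \<in> words k L" for v
        using that w by (intro cyl_weight_nonneg[of _ "L + n"]) (auto simp: words_def)
      have "?lhs = (\<Sum>v\<in>words k L - {C}. cyl_weight P p (v @ w) * indicator (proj s (v @ w)) x)"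
        using C(2) by (subst sum.remove[OF finite_words CL]) simp
      also have "\<dots> \<le> (\<Sum>v\<in>words k L - {C}. cyl_weight P p (v @ w))"
        using nn by (intro sum_mono) (auto simp: indicator_def)
      also have "\<dots> = cyl_weight P p w - cyl_weight P p (C @ w)"
        using sum.remove[OF _ CL, of "\<lambda>v. cyl_weight P p (v @ w)"] sum_cyl_weight_prefix[OF w, of L]
        by simp
      also have "\<dots> \<le> (1 - \<delta>) * cyl_weight P p w"
        using block[OF w] C by (auto simp: algebra_simps)
      finally show ?thesis using True by simp
    qed
    then show ?thesis
      unfolding covering_weight_def sum_words_append sum_distrib_left by (intro sum_mono)
  qed
  with AB(3) \<delta>01 that show ?thesis by blast
qed

lemma covering_weight_decay:
  obtains C lam where "0 < C" "0 < lam" "lam < 1"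
    "\<And>s n x. covering_weight (cyl_weight P p) s n x \<le> C * lam ^ n"
proof (rule covering_weight_contracts)
  fix L \<delta>
  assume L: "0 < L" and \<delta>: "0 < \<delta>" "\<delta> < 1"
    and step: "\<And>s n x. covering_weight (cyl_weight P p) s (L + n) x \<le> (1 - \<delta>) * covering_weight (cyl_weight P p) s n x"
  have iter: "covering_weight (cyl_weight P p) s (j * L + r) x \<le> (1 - \<delta>) ^ j" for s j r x
  proof (induction j)
    case (Suc j)
    have "covering_weight (cyl_weight P p) s (Suc j * L + r) x \<le> (1 - \<delta>) * covering_weight (cyl_weight P p) s (j * L + r) x"
      using step[of s "j * L + r" x] by (simp add: add.assoc)
    also have "\<dots> \<le> (1 - \<delta>) * (1 - \<delta>) ^ j" using Suc \<delta> by (intro mult_left_mono) auto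
    finally show ?case by simp
  qed (simp add: covering_weight_le_1)
  define lam where "lam = root L (1 - \<delta>)"
  have lam: "0 < lam" "lam < 1" "lam ^ L = 1 - \<delta>" using L \<delta> by (auto simp: lam_def)
  \<comment> \<open>The contraction happens only once every L steps; the prefactor pays for the incomplete last block.\<close>
  show ?thesis
  proof (rule that[of "1 / lam ^ L" lam])
    show "covering_weight (cyl_weight P p) s n x \<le> 1 / lam ^ L * lam ^ n" for s n x
    proof -
      have "covering_weight (cyl_weight P p) s n x \<le> (1 - \<delta>) ^ (n div L)"
        using iter[of s "n div L" "n mod L" x] by simp
      also have "\<dots> = lam ^ (L * (n div L))" by (simp add: lam power_mult)
      also have "\<dots> = lam ^ (L * (n div L)) * lam ^ L / lam ^ L" using lam \<delta> by simp
      also have "\<dots> \<le> lam ^ n / lam ^ L"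
      proof (rule divide_right_mono)
        have "n \<le> L * (n div L) + L"
          using mult_div_mod_eq[of L n] mod_less_divisor[OF L, of n] by linarith
        then show "lam ^ (L * (n div L)) * lam ^ L \<le> lam ^ n"
          unfolding power_add[symmetric] using lam by (intro power_decreasing) auto
      qed (use lam(1) in simp)
      finally show ?thesis by simp
    qed
  qed (use lam \<delta> in simp_all)
qed

end

section \<open>Two-sided Markov measures\<close>

text \<open>By Markov's inequality the exceptional events have probability at most \<open>C * q ^
  n\<close>, which is summable: half of the exponential rate is spent on the Borel--Cantelli
  lemma.\<close>

lemma (in prob_space) eventually_le_of_geometric_expectation:
  assumes int: "\<And>n. integrable M (X n)" and nonneg: "\<And>n \<omega>. \<omega> \<in> space M \<Longrightarrow> 0 \<le> (X n \<omega> :: real)"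
    and bound: "\<And>n. expectation (X n) \<le> C * (q ^ n) ^ 2" and q: "0 < q" "q < 1"
  shows "AE \<omega> in M. \<forall>\<^sub>F n in sequentially. X n \<omega> \<le> q ^ n"
proof -
  define E where "E n = {\<omega> \<in> space M. q ^ n \<le> X n \<omega>}" for n
  have [measurable]: "X n \<in> borel_measurable M" for n using int by auto
  have E[measurable]: "E n \<in> sets M" for n unfolding E_def by measurable
  have le: "measure M (E n) \<le> C * q ^ n" for n
  proof -
    have "measure M (E n) \<le> expectation (X n) / q ^ n" unfolding E_def
      using int nonneg q by (intro integral_Markov_inequality_measure[where A = "{}"]) auto
    also have "\<dots> \<le> C * (q ^ n) ^ 2 / q ^ n" using bound q by (intro divide_right_mono) auto
    also have "\<dots> = C * q ^ n" using q by (simp add: power2_eq_square)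
    finally show ?thesis .
  qed
  have "AE \<omega> in M. \<forall>\<^sub>F n in sequentially. \<omega> \<in> space M - E n"
  proof (rule borel_cantelli_AE1)
    show "summable (\<lambda>n. measure M (E n))"
    proof (rule summable_comparison_test')
      show "summable (\<lambda>n. C * q ^ n)" using q by (intro summable_mult summable_geometric) simp
      show "norm (measure M (E n)) \<le> C * q ^ n" for n using le by simp
    qed
  qed (simp_all add: E emeasure_eq_measure)
  then show ?thesis
    by eventually_elim (auto simp: E_def elim: eventually_mono)
qed

locale markov_shift = stationary_chain k P p for k P p +
  fixes \<PP> :: "(int \<Rightarrow> nat) measure"
  assumes markov: "markov_measure k P p \<PP>"
begin

sublocale prob_space \<PP>
  using markov by (simp add: markov_measure_def)

lemma sets_PP [measurable_cong]: "sets \<PP> = sets (seq_algebra k)"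
  using markov by (simp add: markov_measure_def)

lemma space_PP: "space \<PP> = Seqs k"
  using sets_eq_imp_space_eq[OF sets_PP]
  by (auto simp: seq_algebra_def space_PiM Seqs_def PiE_def Pi_def)

lemma measurable_coord [measurable]: "(\<lambda>\<theta>. \<theta> i) \<in> measurable \<PP> (count_space UNIV)"
proof -
  have "(\<lambda>\<theta>. \<theta> i) \<in> measurable (seq_algebra k) (count_space {1..k})"
    unfolding seq_algebra_def by measurable
  moreover have "(\<lambda>x. x) \<in> measurable (count_space {1..k}) (count_space UNIV)" by simp
  ultimately show ?thesis
    using measurable_compose measurable_cong_sets[OF sets_PP refl] by blast
qed

lemma measurable_shift: "shift \<in> measurable \<PP> \<PP>"
proof -
  have "shift \<in> measurable \<PP> (seq_algebra k)"
    unfolding seq_algebra_def shift_def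
  proof (rule measurable_PiM_single')
    show "(\<lambda>\<theta>. \<theta> (i + 1)) \<in> measurable \<PP> (count_space {1..k})" for i
      using measurable_coord[of "i + 1"]
      by (auto simp: measurable_count_space_eq2 space_PP Seqs_def measurable_def)
    show "(\<lambda>\<theta> i. \<theta> (i + 1)) \<in> space \<PP> \<rightarrow> (\<Pi>\<^sub>E i\<in>UNIV. space (count_space {1..k}))"
      by (auto simp: space_PP Seqs_def)
  qed
  then show ?thesis using measurable_cong_sets[OF refl sets_PP] by blast
qed

lemma measurable_funpow_shift [measurable]: "(shift ^^ n) \<in> measurable \<PP> \<PP>"
proof (induction n)
  case (Suc n)
  then show ?case unfolding funpow.simps by (rule measurable_comp[OF _ measurable_shift])
qed (simp add: id_def)

lemma distr_funpow_shift: "distr \<PP> \<PP> (shift ^^ n) = \<PP>"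
proof (induction n)
  case 0
  then show ?case by (simp add: id_def distr_id)
next
  case (Suc n)
  have 1: "distr \<PP> \<PP> shift = \<PP>"
    using markov distr_cong[OF refl sets_PP, of \<PP> shift shift] by (simp add: markov_measure_def)
  have "distr \<PP> \<PP> (shift ^^ Suc n) = distr (distr \<PP> \<PP> (shift ^^ n)) \<PP> shift"
    unfolding funpow.simps by (rule distr_distr[OF measurable_shift measurable_funpow_shift, symmetric])
  also have "\<dots> = \<PP>" unfolding Suc by (rule 1)
  finally show ?case .
qed

lemma prob_funpow_shift:
  assumes "{\<theta> \<in> space \<PP>. Q \<theta>} \<in> sets \<PP>"
  shows "\<P>(\<theta> in \<PP>. Q ((shift ^^ n) \<theta>)) = \<P>(\<theta> in \<PP>. Q \<theta>)"
proof -
  have "\<P>(\<theta> in \<PP>. Q \<theta>) = measure (distr \<PP> \<PP> (shift ^^ n)) {\<theta> \<in> space \<PP>. Q \<theta>}"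
    by (simp add: distr_funpow_shift)
  also have "\<dots> = measure \<PP> ((shift ^^ n) -` {\<theta> \<in> space \<PP>. Q \<theta>} \<inter> space \<PP>)"
    using assms by (intro measure_distr) auto
  also have "(shift ^^ n) -` {\<theta> \<in> space \<PP>. Q \<theta>} \<inter> space \<PP> = {\<theta> \<in> space \<PP>. Q ((shift ^^ n) \<theta>)}"
    using measurable_space[OF measurable_funpow_shift] by auto
  finally show ?thesis by simp
qed

lemma AE_funpow_shift:
  assumes "AE \<theta> in \<PP>. Q \<theta>"
  shows "AE \<theta> in \<PP>. Q ((shift ^^ n) \<theta>)"
proof -
  have "AE \<theta> in distr \<PP> \<PP> (shift ^^ n). Q \<theta>" using assms by (simp only: distr_funpow_shift)
  then show ?thesis by (rule AE_distrD[rotated]) simp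
qed

lemma integral_funpow_shift:
  fixes g :: "(int \<Rightarrow> nat) \<Rightarrow> real"
  assumes "g \<in> borel_measurable \<PP>"
  shows "(LINT \<theta>|\<PP>. g ((shift ^^ n) \<theta>)) = (LINT \<theta>|\<PP>. g \<theta>)"
  using integral_distr[OF measurable_funpow_shift[of n] assms] by (simp add: distr_funpow_shift)

text \<open>Shift invariance extends the starting vector from time zero to all times. For negative
  times the shift is applied to the event at the negative time.\<close>

lemma prob_coord:
  assumes "a \<in> {1..k}"
  shows "\<P>(\<theta> in \<PP>. \<theta> s = a) = p a"
proof (cases "0 \<le> s")
  case True
  have "\<P>(\<theta> in \<PP>. \<theta> s = a) = \<P>(\<theta> in \<PP>. \<theta> 0 = a)"
    using prob_funpow_shift[of "\<lambda>\<theta>. \<theta> 0 = a" "nat s"] True by (simp add: funpow_shift)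
  then show ?thesis using markov assms by (simp add: markov_measure_def)
next
  case False
  have "\<P>(\<theta> in \<PP>. \<theta> s = a) = \<P>(\<theta> in \<PP>. \<theta> 0 = a)"
    using prob_funpow_shift[of "\<lambda>\<theta>. \<theta> s = a" "nat (- s)"] False by (simp add: funpow_shift)
  then show ?thesis using markov assms by (simp add: markov_measure_def)
qed

text \<open>The Markov property says nothing about cylinders of probability zero; for these,
  monotonicity and the induction hypothesis show that both sides vanish.\<close>

lemma prob_cylinder:
  assumes "\<forall>i\<le>n. a i \<in> {1..k}"
  shows "\<P>(\<theta> in \<PP>. \<forall>i\<le>n. \<theta> (s + int i) = a i) = p (a 0) * (\<Prod>i<n. P (a i) (a (Suc i)))"
  using assms
proof (induction n)
  case 0
  then show ?case using prob_coord[of "a 0" s] by simp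
next
  case (Suc n)
  let ?E = "\<lambda>\<theta>. \<forall>i\<le>n. \<theta> (s + int i) = a i"
  have eq: "(\<forall>i\<le>Suc n. \<theta> (s + int i) = a i) \<longleftrightarrow> \<theta> (s + int n + 1) = a (Suc n) \<and> ?E \<theta>" for \<theta>
    by (auto simp: le_Suc_eq algebra_simps)
  have IH: "\<P>(\<theta> in \<PP>. ?E \<theta>) = p (a 0) * (\<Prod>i<n. P (a i) (a (Suc i)))"
    using Suc by auto
  show ?case
  proof (cases "0 < \<P>(\<theta> in \<PP>. ?E \<theta>)")
    case True
    have "\<P>(\<theta> in \<PP>. \<theta> (s + int n + 1) = a (Suc n) \<bar> ?E \<theta>) = P (a n) (a (Suc n))"
      using markov True Suc.prems unfolding markov_measure_def by blast
    then have "\<P>(\<theta> in \<PP>. \<theta> (s + int n + 1) = a (Suc n) \<and> ?E \<theta>)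
        = P (a n) (a (Suc n)) * \<P>(\<theta> in \<PP>. ?E \<theta>)"
      using True unfolding cond_prob_def by (simp add: divide_eq_eq)
    then show ?thesis unfolding eq IH by (simp add: mult_ac)
  next
    case False
    then have 0: "\<P>(\<theta> in \<PP>. ?E \<theta>) = 0" by (simp add: order_less_le)
    have "\<P>(\<theta> in \<PP>. \<forall>i\<le>Suc n. \<theta> (s + int i) = a i) \<le> \<P>(\<theta> in \<PP>. ?E \<theta>)"
      by (intro finite_measure_mono) (auto simp: eq)
    with 0 have "\<P>(\<theta> in \<PP>. \<forall>i\<le>Suc n. \<theta> (s + int i) = a i) = 0"
      by (simp add: measure_le_0_iff)
    moreover have "p (a 0) * (\<Prod>i<Suc n. P (a i) (a (Suc i)))
        = \<P>(\<theta> in \<PP>. ?E \<theta>) * P (a n) (a (Suc n))" by (simp add: IH)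
    ultimately show ?thesis using 0 by simp
  qed
qed

lemma prob_past:
  assumes "w \<in> words k n"
  shows "\<P>(\<theta> in \<PP>. past \<theta> n = w) = cyl_weight P p w"
proof (cases n)
  case 0
  then show ?thesis using assms prob_space by (simp add: words_def cyl_weight_def)
next
  case (Suc m)
  then have w: "length w = Suc m" "set w \<subseteq> {1..k}" using assms by (auto simp: words_def)
  then have "\<forall>i\<le>m. w ! i \<in> {1..k}" by (metis nth_mem subsetD le_imp_less_Suc)
  moreover have "w \<noteq> []" using w by auto
  ultimately show ?thesis
    using prob_cylinder[of m "\<lambda>i. w ! i" "- int (Suc m)"] w
    unfolding Suc past_eq_iff[OF w(1)] cyl_weight_def path_weight_eq_prod
    by (simp add: hd_conv_nth)
qed

lemma measurable_past [measurable]: "(\<lambda>\<theta>. past \<theta> n) \<in> measurable \<PP> (count_space UNIV)"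
proof (induction n)
  case (Suc n)
  have "(\<lambda>\<theta>. a # past \<theta> n) \<in> measurable \<PP> (count_space UNIV)" for a
    by (rule measurable_compose[OF Suc]) simp
  then show ?case unfolding past.simps
    by (rule measurable_compose_countable'[OF _ measurable_coord]) auto
qed simp

text \<open>A function of the past of fixed length takes finitely many values, one on each
  cylinder.\<close>

lemma expectation_past:
  fixes g :: "nat list \<Rightarrow> real"
  shows "integrable \<PP> (\<lambda>\<theta>. g (past \<theta> n))" (is ?int)
    and "expectation (\<lambda>\<theta>. g (past \<theta> n)) = (\<Sum>w\<in>words k n. cyl_weight P p w * g w)" (is ?exp)
proof -
  have E: "{\<theta> \<in> space \<PP>. past \<theta> n = w} \<in> sets \<PP>" for w by measurable
  have sum: "g (past \<theta> n) = (\<Sum>w\<in>words k n. indicator {\<theta> \<in> space \<PP>. past \<theta> n = w} \<theta> * g w)"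
    if "\<theta> \<in> space \<PP>" for \<theta>
  proof -
    have "(\<Sum>w\<in>words k n. indicator {\<theta> \<in> space \<PP>. past \<theta> n = w} \<theta> * g w)
        = (\<Sum>w\<in>words k n. if past \<theta> n = w then g w else 0)"
      using that by (intro sum.cong) auto
    then show ?thesis using past_in_words[of \<theta> k n] that by (simp add: space_PP)
  qed
  have "integrable \<PP> (\<lambda>\<theta>. \<Sum>w\<in>words k n. indicator {\<theta> \<in> space \<PP>. past \<theta> n = w} \<theta> * g w)"
    using E by (intro Bochner_Integration.integrable_sum integrable_mult_left)
      (auto simp: integrable_indicator_iff less_top[symmetric])
  then show ?int by (subst Bochner_Integration.integrable_cong[OF refl sum])
  have "expectation (\<lambda>\<theta>. g (past \<theta> n))
      = expectation (\<lambda>\<theta>. \<Sum>w\<in>words k n. indicator {\<theta> \<in> space \<PP>. past \<theta> n = w} \<theta> * g w)"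
    by (rule Bochner_Integration.integral_cong[OF refl sum])
  also have "\<dots> = (\<Sum>w\<in>words k n. expectation (\<lambda>\<theta>. indicator {\<theta> \<in> space \<PP>. past \<theta> n = w} \<theta> * g w))"
    using E by (intro Bochner_Integration.integral_sum integrable_mult_left)
      (auto simp: integrable_indicator_iff less_top[symmetric])
  also have "\<dots> = (\<Sum>w\<in>words k n. cyl_weight P p w * g w)"
    using E by (intro sum.cong) (auto simp: prob_past)
  finally show ?exp .
qed

end

section \<open>The coding map\<close>

lemma dist_le_d1: "dist x y \<le> d1 x y"
  unfolding dist_norm d1_def using norm_le_l1_cart[of "x - y"] by simp

context fiber_maps
begin

lemma set_past: "\<theta> \<in> Seqs k \<Longrightarrow> set (past \<theta> n) \<subseteq> {1..k}"
  using past_in_words[of \<theta> k n] by (simp add: words_def)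

lemma bwd_image_antimono:
  assumes "\<theta> \<in> Seqs k" "m \<le> n"
  shows "bwd f \<theta> n ` M \<subseteq> bwd f \<theta> m ` M"
  using assms(2)
proof (induction rule: dec_induct)
  case (step n)
  have "set [\<theta> (- int (Suc n))] \<subseteq> {1..k}" using assms(1) by (auto simp: Seqs_def)
  from fold_append_subset[OF this, of "past \<theta> n"] have "bwd f \<theta> (Suc n) ` M \<subseteq> bwd f \<theta> n ` M"
    by (simp add: bwd_eq_fold)
  with step show ?case by blast
qed simp

lemma compact_bwd_image: "\<theta> \<in> Seqs k \<Longrightarrow> compact (bwd f \<theta> n ` M)"
  unfolding bwd_eq_fold by (intro compact_fold set_past)

lemma Inter_bwd_image_nonempty: "\<theta> \<in> Seqs k \<Longrightarrow> (\<Inter>n. bwd f \<theta> n ` M) \<noteq> {}"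
  using compact_nest[of "\<lambda>n. bwd f \<theta> n ` M"] compact_bwd_image bwd_image_antimono M_nonempty
  by auto

text \<open>The condition on the right is a countable combination of conditions on finitely many
  symbols, so it makes \<open>S_F\<close> measurable. If the widths become small, two points of
  the intersection have distance zero. Conversely, if the intersection is a point, then by
  compactness the images eventually enter every ball around it.\<close>

lemma S_F_iff_width:
  assumes \<theta>: "\<theta> \<in> Seqs k"
  shows "\<theta> \<in> S_F k M f \<longleftrightarrow> (\<forall>m::nat. \<exists>n. width (past \<theta> n) < 1 / Suc m)"
proof
  assume small: "\<forall>m::nat. \<exists>n. width (past \<theta> n) < 1 / Suc m"
  have "y = z" if yz: "y \<in> (\<Inter>n. bwd f \<theta> n ` M)" "z \<in> (\<Inter>n. bwd f \<theta> n ` M)" for y z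
  proof -
    have "dist y z < 1 / Suc m" for m
    proof -
      obtain n where "width (past \<theta> n) < 1 / Suc m" using small by blast
      moreover have "d1 y z \<le> width (past \<theta> n)"
        using yz \<theta> by (intro d1_le_width set_past) (auto simp: bwd_eq_fold)
      ultimately show ?thesis using dist_le_d1[of y z] by linarith
    qed
    then show ?thesis using nat_approx_posE[of "dist y z"] by (metis not_less_iff_gr_or_eq zero_less_dist_iff)
  qed
  moreover obtain y where "y \<in> (\<Inter>n. bwd f \<theta> n ` M)" using Inter_bwd_image_nonempty[OF \<theta>] by blast
  ultimately have "(\<Inter>n. bwd f \<theta> n ` M) = {y}" by blast
  then show "\<theta> \<in> S_F k M f" using \<theta> by (simp add: S_F_def)
next
  assume "\<theta> \<in> S_F k M f"
  then obtain y where y: "(\<Inter>n. bwd f \<theta> n ` M) = {y}" by (auto simp: S_F_def is_singleton_def)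
  show "\<forall>m::nat. \<exists>n. width (past \<theta> n) < 1 / Suc m"
  proof
    fix m
    define e where "e = 1 / (4 * real CARD('m) * Suc m)"
    have e: "0 < e" by (simp add: e_def)
    have "\<exists>n. bwd f \<theta> n ` M - ball y e = {}"
    proof (rule ccontr)
      assume none: "\<not> ?thesis"
      have "\<Inter>(range (\<lambda>n. bwd f \<theta> n ` M - ball y e)) \<noteq> {}"
      proof (rule compact_nest)
        show "compact (bwd f \<theta> n ` M - ball y e)" for n
          by (intro compact_diff compact_bwd_image \<theta> open_ball)
        show "bwd f \<theta> n ` M - ball y e \<noteq> {}" for n using none by blast
        show "bwd f \<theta> n ` M - ball y e \<subseteq> bwd f \<theta> m ` M - ball y e" if "m \<le> n" for m n
          by (intro Diff_mono bwd_image_antimono \<theta> that order_refl)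
      qed
      then show False using y e by auto
    qed
    then obtain n where n: "fold f (past \<theta> n) ` M \<subseteq> ball y e" by (auto simp: bwd_eq_fold)
    have "measure lborel (proj s (past \<theta> n)) \<le> 2 * e" for s
    proof -
      have "\<bar>y $ s - x $ s\<bar> \<le> e" if "x \<in> fold f (past \<theta> n) ` M" for x
        using n that component_le_norm_cart[of "y - x" s] by (auto simp: subset_iff dist_norm)
      then have "proj s (past \<theta> n) \<subseteq> {y $ s - e .. y $ s + e}"
        unfolding proj_def by (force simp: abs_le_iff)
      from measure_proj_le[OF set_past[OF \<theta>] this] e show ?thesis by simp
    qed
    then have "width (past \<theta> n) \<le> (\<Sum>s\<in>(UNIV::'m set). 2 * e)"
      unfolding width_def by (intro sum_mono)
    also have "\<dots> = 1 / (2 * real (Suc m))" by (simp add: e_def divide_simps del: of_nat_Suc)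
    also have "\<dots> < 1 / Suc m" by (simp add: divide_simps del: of_nat_Suc)
    finally show "\<exists>n. width (past \<theta> n) < 1 / Suc m" by blast
  qed
qed

lemma coding_limit:
  assumes \<theta>: "\<theta> \<in> S_F k M f"
  shows "x \<in> M \<Longrightarrow> (\<lambda>n. bwd f \<theta> n x) \<longlonglongrightarrow> coding M f \<theta>"
    and "coding M f \<theta> \<in> bwd f \<theta> n ` M"
proof -
  have seq: "\<theta> \<in> Seqs k" using \<theta> by (simp add: S_F_def)
  obtain y where y: "(\<Inter>n. bwd f \<theta> n ` M) = {y}" using \<theta> by (auto simp: S_F_def is_singleton_def)
  have lim: "(\<lambda>n. bwd f \<theta> n x) \<longlonglongrightarrow> y" if x: "x \<in> M" for x
  proof (rule metric_LIMSEQ_I)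
    fix e :: real assume "0 < e"
    then obtain m where m: "1 / Suc m < e" using nat_approx_posE by blast
    obtain n0 where n0: "width (past \<theta> n0) < 1 / Suc m"
      using \<theta> S_F_iff_width[OF seq] by blast
    have "dist (bwd f \<theta> n x) y < e" if "n0 \<le> n" for n
    proof -
      have "bwd f \<theta> n x \<in> bwd f \<theta> n0 ` M" using bwd_image_antimono[OF seq that] x by blast
      moreover have "y \<in> bwd f \<theta> n0 ` M" using y by blast
      ultimately have "d1 (bwd f \<theta> n x) y \<le> width (past \<theta> n0)"
        using d1_le_width[OF set_past[OF seq]] by (simp add: bwd_eq_fold)
      then show ?thesis using n0 m dist_le_d1[of "bwd f \<theta> n x" y] by linarith
    qed
    then show "\<exists>n0. \<forall>n\<ge>n0. dist (bwd f \<theta> n x) y < e" by blast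
  qed
  have "coding M f \<theta> = y" unfolding coding_def
    using lim M_nonempty LIMSEQ_unique by (intro the_equality) blast+
  then show "x \<in> M \<Longrightarrow> (\<lambda>n. bwd f \<theta> n x) \<longlonglongrightarrow> coding M f \<theta>"
    and "coding M f \<theta> \<in> bwd f \<theta> n ` M" using lim y by blast+
qed

text \<open>Both points belong to the image of \<open>M\<close> along the past of length
  \<open>n\<close> of the shifted sequence.\<close>

lemma d1_fwd_coding_le:
  assumes "\<theta> \<in> Seqs k" "(shift ^^ n) \<theta> \<in> S_F k M f" "x \<in> M"
  shows "d1 (fwd f \<theta> n x) (coding M f ((shift ^^ n) \<theta>)) \<le> width (past ((shift ^^ n) \<theta>) n)"
proof (rule d1_le_width)
  show "set (past ((shift ^^ n) \<theta>) n) \<subseteq> {1..k}" using assms by (intro set_past) (simp add: S_F_def)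
  show "fwd f \<theta> n x \<in> fold f (past ((shift ^^ n) \<theta>) n) ` M"
    using assms by (simp add: fwd_eq_bwd_shift bwd_eq_fold)
  show "coding M f ((shift ^^ n) \<theta>) \<in> fold f (past ((shift ^^ n) \<theta>) n) ` M"
    using coding_limit(2)[OF assms(2), of n] by (simp add: bwd_eq_fold)
qed

lemma dprod_skew_coding_le:
  assumes "\<theta> \<in> Seqs k" "(shift ^^ n) \<theta> \<in> S_F k M f" "x \<in> M"
  shows "dprod ((skew f ^^ n) (\<theta>, x)) (coding_hat M f ((shift ^^ n) \<theta>))
    \<le> width (past ((shift ^^ n) \<theta>) n)"
  using d1_fwd_coding_le[OF assms]
  by (simp add: dprod_def coding_hat_def funpow_skew d0_def)

lemma coding_in_M: "\<theta> \<in> S_F k M f \<Longrightarrow> coding M f \<theta> \<in> M"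
  using coding_limit(2)[of \<theta> 0] by simp

end

section \<open>Lipschitz functions and measurability on the product\<close>

lemma d0_le_of_agree:
  assumes "\<And>i. \<bar>i\<bar> \<le> int n \<Longrightarrow> \<theta> i = \<xi> i"
  shows "d0 \<theta> \<xi> \<le> (1 / 2) ^ n"
proof (cases "\<theta> = \<xi>")
  case False
  then obtain i where "\<theta> i \<noteq> \<xi> i" by blast
  then have "\<exists>m. \<exists>i. m = nat \<bar>i\<bar> \<and> \<theta> i \<noteq> \<xi> i" by blast
  from LeastI_ex[OF this] obtain j
    where j: "(LEAST m. \<exists>i. m = nat \<bar>i\<bar> \<and> \<theta> i \<noteq> \<xi> i) = nat \<bar>j\<bar>" "\<theta> j \<noteq> \<xi> j" by blast
  then have "n \<le> nat \<bar>j\<bar>" using assms[of j] by linarith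
  then show ?thesis unfolding d0_def j(1) using False by (simp add: power_decreasing)
qed (simp add: d0_def)

lemma d0_nonneg: "0 \<le> d0 \<theta> \<xi>" and d0_le_1: "d0 \<theta> \<xi> \<le> 1"
  by (simp_all add: d0_def power_le_one)

text \<open>The metric \<open>d0\<close> is continuous for the product topology: nearby sequences
  agree on any given finite window.\<close>

lemma tendsto_d0: "((\<lambda>\<theta>. d0 \<theta> \<xi>) \<longlongrightarrow> 0) (at \<xi> within S)"
proof (rule tendstoI)
  fix e :: real assume "0 < e"
  then obtain n where n: "(1 / 2) ^ n < e" using real_arch_pow_inv[of e "1/2"] by auto
  have "\<forall>\<^sub>F \<theta> in at \<xi> within S. \<theta> i = \<xi> i" for i
  proof -
    have "((\<lambda>\<theta>. \<theta> i) \<longlongrightarrow> \<xi> i) (at \<xi> within S)"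
      using continuous_on_product_coordinates[where i = i and ?'b = nat]
      by (auto simp: continuous_on_def intro: tendsto_within_subset)
    then show ?thesis by (simp add: tendsto_discrete)
  qed
  then have "\<forall>\<^sub>F \<theta> in at \<xi> within S. \<forall>i\<in>{- int n..int n}. \<theta> i = \<xi> i"
    by (intro eventually_ball_finite) auto
  then show "\<forall>\<^sub>F \<theta> in at \<xi> within S. dist (d0 \<theta> \<xi>) 0 < e"
  proof eventually_elim
    case (elim \<theta>)
    then have "d0 \<theta> \<xi> \<le> (1 / 2) ^ n" by (intro d0_le_of_agree) (simp add: abs_le_iff)
    then show ?case using n d0_nonneg[of \<theta> \<xi>] by simp
  qed
qed

lemma Lip1D:
  assumes "\<phi> \<in> Lip1 k M" and z: "z \<in> Seqs k \<times> M" and w: "w \<in> Seqs k \<times> M"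
  shows "\<bar>\<phi> z - \<phi> w\<bar> \<le> dprod z w"
proof -
  have "\<forall>z\<in>Seqs k \<times> M. \<forall>w\<in>Seqs k \<times> M. \<bar>\<phi> z - \<phi> w\<bar> \<le> dprod z w"
    using assms(1) by (simp only: Lip1_def mem_Collect_eq)
  from bspec[OF bspec[OF this z] w] show ?thesis .
qed

lemma Lip1_continuous:
  fixes M :: "(real ^ 'm) set"
  assumes "\<phi> \<in> Lip1 k M"
  shows "continuous_on (Seqs k \<times> M) \<phi>"
  unfolding continuous_on_def
proof
  fix z assume z: "z \<in> Seqs k \<times> M"
  let ?F = "at z within Seqs k \<times> M"
  have id: "((\<lambda>w. w) \<longlongrightarrow> z) ?F" by (rule tendsto_ident_at)
  have "filterlim fst (nhds (fst z)) ?F" using tendsto_fst[OF id] by simp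
  moreover have "((\<lambda>\<theta>. d0 \<theta> (fst z)) \<longlongrightarrow> 0) (nhds (fst z))"
    using tendsto_d0[of "fst z" UNIV] tendsto_at_iff_tendsto_nhds[of "\<lambda>\<theta>. d0 \<theta> (fst z)" "fst z"]
    by (simp add: d0_def)
  ultimately have "((\<lambda>w. d0 (fst w) (fst z)) \<longlongrightarrow> 0) ?F"
    by (rule filterlim_compose[rotated])
  moreover have "((\<lambda>w. d1 (snd w) (snd z)) \<longlongrightarrow> d1 (snd z) (snd z)) ?F"
    unfolding d1_def by (intro tendsto_intros id)
  ultimately have "((\<lambda>w. dprod w z) \<longlongrightarrow> 0 + d1 (snd z) (snd z)) ?F"
    unfolding dprod_def by (rule tendsto_add)
  then have "((\<lambda>w. dprod w z) \<longlongrightarrow> 0) ?F" by (simp add: d1_def)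
  moreover have "\<forall>\<^sub>F w in ?F. dist (\<phi> w) (\<phi> z) \<le> dprod w z"
    unfolding eventually_at_filter
    by (rule always_eventually) (use assms z in \<open>unfold Lip1_def dist_real_def, blast\<close>)
  ultimately have "((\<lambda>w. dist (\<phi> w) (\<phi> z)) \<longlongrightarrow> 0) ?F"
    by (intro Lim_null_comparison[of "\<lambda>w. dist (\<phi> w) (\<phi> z)"]) simp_all
  then show "(\<phi> \<longlongrightarrow> \<phi> z) ?F" by (rule tendsto_dist_iff[THEN iffD2])
qed

text \<open>This matters because the integral of a nonmeasurable function would be zero by
  convention: all test functions in the Wasserstein distance are genuinely integrated.\<close>

lemma Lip1_measurable: "\<phi> \<in> Lip1 k M \<Longrightarrow> \<phi> \<in> borel_measurable (total_algebra k M)"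
  unfolding total_algebra_def by (intro borel_measurable_continuous_on_restrict Lip1_continuous)

lemma space_total_algebra: "space (total_algebra k M) = Seqs k \<times> M"
  by (simp add: total_algebra_def space_restrict_space)

lemma measurable_total_coord:
  fixes M :: "(real ^ 'm) set"
  shows "(\<lambda>z. fst z i) \<in> measurable (total_algebra k M) (count_space {1..k})"
proof -
  have "(\<lambda>z::(int \<Rightarrow> nat) \<times> (real ^ 'm). fst z i) \<in> borel_measurable borel"
    by (intro borel_measurable_continuous_onI, rule continuous_on_compose2[OF continuous_on_product_coordinates])
      (rule continuous_on_fst[OF continuous_on_id], simp)
  then have "(\<lambda>z. fst z i) \<in> borel_measurable (total_algebra k M)"
    unfolding total_algebra_def by (rule measurable_restrict_space1)
  then have "(\<lambda>z. fst z i) \<in> measurable (total_algebra k M) (count_space UNIV)"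
    using measurable_cong_sets[OF refl sets_borel_eq_count_space] by blast
  then show ?thesis
    by (auto simp: measurable_count_space_eq2 space_total_algebra Seqs_def measurable_def)
qed

lemma measurable_fst_total: "fst \<in> measurable (total_algebra k M) (seq_algebra k)"
proof -
  have "(\<lambda>z i. fst z i) \<in> measurable (total_algebra k M) (seq_algebra k)"
    unfolding seq_algebra_def
    by (rule measurable_PiM_single'[OF measurable_total_coord])
      (auto simp: space_total_algebra Seqs_def)
  then show ?thesis by simp
qed

lemma measurable_snd_total: "snd \<in> measurable (total_algebra k M) (restrict_space borel M)"
  unfolding total_algebra_def
  by (intro measurable_restrict_space2 measurable_restrict_space1 borel_measurable_continuous_onI
      continuous_intros) (auto simp: space_restrict_space)

text \<open>The Borel sets of the sequence space are generated by the coordinates, as it is a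
  countable product of second countable spaces.\<close>

lemma measurable_into_total:
  assumes coord: "\<And>i. (\<lambda>x. fst (g x) i) \<in> measurable N (count_space UNIV)"
    and snd: "(\<lambda>x. snd (g x)) \<in> borel_measurable N"
    and space: "\<And>x. x \<in> space N \<Longrightarrow> g x \<in> Seqs k \<times> M"
  shows "g \<in> measurable N (total_algebra k M)"
  unfolding total_algebra_def
proof (rule measurable_restrict_space2)
  have "(\<lambda>x. fst (g x)) \<in> borel_measurable N"
    using coord measurable_cong_sets[OF refl sets_borel_eq_count_space]
    by (intro measurable_coordinatewise_then_product) blast
  then have "(\<lambda>x. (fst (g x), snd (g x))) \<in> borel_measurable N"
    using snd by (rule borel_measurable_Pair)
  then show "g \<in> borel_measurable N" by simp
qed (use space in blast)

lemma (in fiber_maps) measurable_skew: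
  "skew f \<in> measurable (total_algebra k M) (total_algebra k M)"
proof (rule measurable_into_total)
  have UNIV: "(\<lambda>z. fst z i) \<in> measurable (total_algebra k M) (count_space UNIV)" for i
    by (rule measurable_compose[OF measurable_total_coord]) simp
  show "(\<lambda>z. fst (skew f z) i) \<in> measurable (total_algebra k M) (count_space UNIV)" for i
    using UNIV[of "i + 1"] by (simp add: skew_def shift_def)
  have "(\<lambda>z. f i (snd z)) \<in> borel_measurable (total_algebra k M)" if "i \<in> {1..k}" for i
    using maps that
    by (intro measurable_compose[OF measurable_snd_total] borel_measurable_continuous_on_restrict) auto
  then show "(\<lambda>z. snd (skew f z)) \<in> borel_measurable (total_algebra k M)"
    unfolding skew_def snd_conv
    by (rule measurable_compose_countable'[OF _ measurable_total_coord]) auto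
  show "skew f z \<in> Seqs k \<times> M" if "z \<in> space (total_algebra k M)" for z
  proof -
    have z: "fst z \<in> Seqs k" "snd z \<in> M" using that by (auto simp: space_total_algebra)
    then have "fst z 0 \<in> {1..k}" by (simp add: Seqs_def)
    then have "f (fst z 0) (snd z) \<in> M" using maps z by blast
    with z show ?thesis by (simp add: skew_def Seqs_def shift_def)
  qed
qed

lemma (in fiber_maps) measurable_funpow_skew:
  "(skew f ^^ n) \<in> measurable (total_algebra k M) (total_algebra k M)"
proof (induction n)
  case (Suc n)
  then show ?case unfolding funpow.simps by (rule measurable_comp[OF _ measurable_skew])
qed (simp add: id_def)

lemma (in fiber_maps) funpow_skew_push:
  assumes "sets \<mu> = sets (total_algebra k M)"
  shows "(skew_push k M f ^^ n) \<mu> = distr \<mu> (total_algebra k M) (skew f ^^ n)"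
proof (induction n)
  case 0
  then show ?case using distr_id2[OF assms[symmetric]] by (simp add: id_def)
next
  case (Suc n)
  have "(skew f ^^ n) \<in> measurable \<mu> (total_algebra k M)"
    using measurable_funpow_skew measurable_cong_sets[OF assms refl] by blast
  note comp = distr_distr[OF measurable_skew this]
  have "(skew_push k M f ^^ Suc n) \<mu> = skew_push k M f (distr \<mu> (total_algebra k M) (skew f ^^ n))"
    by (simp add: Suc)
  also have "\<dots> = distr \<mu> (total_algebra k M) (skew f ^^ Suc n)"
    unfolding skew_push_def funpow.simps by (rule comp)
  finally show ?case .
qed

section \<open>Skew products that split\<close>

locale splitting_skew_product = split_chain k P p M f u + markov_shift k P p \<PP>
  for k P p and M :: "(real ^ 'm) set" and f u \<PP>
begin

text \<open>The rate is stated as a square, \<open>q\<close> being the square root of the rate of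
  the covering weights, because both applications use up one of the two factors \<open>q ^
  n\<close>.\<close>

lemma expected_width_decay:
  obtains C q where "0 < q" "q < 1" "\<And>n. expectation (\<lambda>\<theta>. width (past \<theta> n)) \<le> C * (q ^ n)\<^sup>2"
proof (rule covering_weight_decay)
  fix C lam :: real
  assume lam: "0 < C" "0 < lam" "lam < 1"
    and cover: "\<And>s n x. covering_weight (cyl_weight P p) s n x \<le> C * lam ^ n"
  show thesis
  proof (rule that[of "sqrt lam" "C * width []"])
    show "expectation (\<lambda>\<theta>. width (past \<theta> n)) \<le> C * width [] * (sqrt lam ^ n)\<^sup>2" for n
    proof -
      have "(sqrt lam ^ n)\<^sup>2 = lam ^ n"
        using lam by (simp add: power_mult[symmetric] mult.commute[of n]) (simp add: power_mult)
      moreover have "(\<Sum>w\<in>words k n. cyl_weight P p w * width w) \<le> C * lam ^ n * width []"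
        by (rule expected_width_le[OF cover cyl_weight_nonneg])
      ultimately show ?thesis using expectation_past(2)[of width n] by (simp add: mult_ac)
    qed
  qed (use lam in auto)
qed

lemma integrable_width_shift: "integrable \<PP> (\<lambda>\<theta>. width (past ((shift ^^ j) \<theta>) n))"
  and expectation_width_shift:
    "expectation (\<lambda>\<theta>. width (past ((shift ^^ j) \<theta>) n)) = expectation (\<lambda>\<theta>. width (past \<theta> n))"
proof -
  have "integrable (distr \<PP> \<PP> (shift ^^ j)) (\<lambda>\<theta>. width (past \<theta> n))"
    using expectation_past(1)[of width n] by (simp only: distr_funpow_shift)
  then show "integrable \<PP> (\<lambda>\<theta>. width (past ((shift ^^ j) \<theta>) n))"
    by (rule integrable_distr[OF measurable_funpow_shift])
  show "expectation (\<lambda>\<theta>. width (past ((shift ^^ j) \<theta>) n)) = expectation (\<lambda>\<theta>. width (past \<theta> n))"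
    using expectation_past(1)[of width n] by (intro integral_funpow_shift) auto
qed

lemma AE_width_decay:
  assumes "0 < q" "q < 1" "\<And>n. expectation (\<lambda>\<theta>. width (past \<theta> n)) \<le> C * (q ^ n)\<^sup>2"
  shows "AE \<theta> in \<PP>. \<forall>\<^sub>F n in sequentially. width (past ((shift ^^ (j n)) \<theta>) n) \<le> q ^ n"
  using assms
  by (intro eventually_le_of_geometric_expectation[where C = C] integrable_width_shift)
    (auto simp: expectation_width_shift width_nonneg)

lemma S_F_measurable: "S_F k M f \<in> sets \<PP>"
proof -
  have [measurable]: "(\<lambda>\<theta>. width (past \<theta> n)) \<in> borel_measurable \<PP>" for n
    using expectation_past(1)[of width n] by auto
  have "S_F k M f = {\<theta> \<in> space \<PP>. \<forall>m::nat. \<exists>n. width (past \<theta> n) < 1 / Suc m}"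
    using S_F_iff_width by (auto simp: space_PP S_F_def)
  also have "\<dots> \<in> sets \<PP>" by measurable
  finally show ?thesis .
qed

lemma AE_S_F: "AE \<theta> in \<PP>. \<theta> \<in> S_F k M f"
proof (rule expected_width_decay)
  fix C q :: real
  assume q: "0 < q" "q < 1" and "\<And>n. expectation (\<lambda>\<theta>. width (past \<theta> n)) \<le> C * (q ^ n)\<^sup>2"
  then have "AE \<theta> in \<PP>. \<forall>\<^sub>F n in sequentially. width (past ((shift ^^ 0) \<theta>) n) \<le> q ^ n"
    by (rule AE_width_decay)
  then show ?thesis
  proof (rule AE_mp, intro AE_I2 impI)
    fix \<theta> assume \<theta>: "\<theta> \<in> space \<PP>"
      and ev: "\<forall>\<^sub>F n in sequentially. width (past ((shift ^^ 0) \<theta>) n) \<le> q ^ n"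
    have "\<exists>n. width (past \<theta> n) < 1 / Suc m" for m :: nat
    proof -
      have "(\<lambda>n. q ^ n) \<longlonglongrightarrow> 0" using q by (intro LIMSEQ_power_zero) simp
      then have "\<forall>\<^sub>F n in sequentially. q ^ n < 1 / Suc m"
        by (rule order_tendstoD) simp
      with ev have "\<forall>\<^sub>F n in sequentially. width (past \<theta> n) < 1 / Suc m"
        by eventually_elim simp
      then show ?thesis by (auto simp: eventually_sequentially)
    qed
    then show "\<theta> \<in> S_F k M f" using \<theta> S_F_iff_width by (simp add: space_PP)
  qed
qed

lemma measurable_coding_hat:
  "coding_hat M f \<in> measurable (restrict_space \<PP> (S_F k M f)) (total_algebra k M)"
proof (rule measurable_into_total)
  show "(\<lambda>\<theta>. fst (coding_hat M f \<theta>) i)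
      \<in> measurable (restrict_space \<PP> (S_F k M f)) (count_space UNIV)" for i
    unfolding coding_hat_def fst_conv by (intro measurable_restrict_space1 measurable_coord)
  obtain x where x: "x \<in> M" using M_nonempty by blast
  have "coding M f \<in> borel_measurable (restrict_space \<PP> (S_F k M f))"
  proof (rule borel_measurable_LIMSEQ_metric)
    show "(\<lambda>\<theta>. bwd f \<theta> n x) \<in> borel_measurable (restrict_space \<PP> (S_F k M f))" for n
      unfolding bwd_eq_fold
      by (intro measurable_restrict_space1 measurable_compose[OF measurable_past]) simp
    show "(\<lambda>n. bwd f \<theta> n x) \<longlonglongrightarrow> coding M f \<theta>"
      if "\<theta> \<in> space (restrict_space \<PP> (S_F k M f))" for \<theta>
      using that x by (intro coding_limit(1)) (auto simp: space_restrict_space)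
  qed
  then show "(\<lambda>\<theta>. snd (coding_hat M f \<theta>)) \<in> borel_measurable (restrict_space \<PP> (S_F k M f))"
    by (simp add: coding_hat_def)
  show "coding_hat M f \<theta> \<in> Seqs k \<times> M" if "\<theta> \<in> space (restrict_space \<PP> (S_F k M f))" for \<theta>
    using that coding_in_M by (auto simp: space_restrict_space coding_hat_def S_F_def)
qed

lemma Lip1_bounded:
  assumes "\<phi> \<in> Lip1 k M"
  shows "\<exists>B. \<forall>z\<in>Seqs k \<times> M. \<bar>\<phi> z\<bar> \<le> B"
proof -
  obtain x where x: "x \<in> M" using M_nonempty by blast
  have c: "(\<lambda>_. 1) \<in> Seqs k" using k_pos by (simp add: Seqs_def)
  have "\<bar>\<phi> z\<bar> \<le> \<bar>\<phi> (\<lambda>_. 1, x)\<bar> + (1 + width [])" if z: "z \<in> Seqs k \<times> M" for z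
  proof -
    have "\<bar>\<phi> z - \<phi> (\<lambda>_. 1, x)\<bar> \<le> dprod z (\<lambda>_. 1, x)"
      using assms z x c unfolding Lip1_def by blast
    also have "\<dots> \<le> 1 + width []" unfolding dprod_def
      using z x by (intro add_mono d0_le_1 d1_le_width) auto
    finally show ?thesis by linarith
  qed
  then show ?thesis by blast
qed

text \<open>A coupling argument. Both integrals are rewritten as integrals over
  \<open>\<mu>\<close>: the first by definition of the push-forward, the second because
  \<open>\<PP>\<close> is shift invariant and is the marginal of \<open>\<mu>\<close>. The
  integrands then compare \<open>\<phi>\<close> at two points over the same base point, whose
  distance is at most the width.\<close>

lemma integral_diff_le_expected_width:
  assumes \<mu>: "\<mu> \<in> measures_over k M \<PP>" and \<phi>: "\<phi> \<in> Lip1 k M"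
  shows "\<bar>integral\<^sup>L ((skew_push k M f ^^ n) \<mu>) \<phi> - integral\<^sup>L (coding_push k M f \<PP>) \<phi>\<bar>
    \<le> expectation (\<lambda>\<theta>. width (past \<theta> n))"
proof -
  let ?T = "total_algebra k M" and ?S = "S_F k M f"
  have sets_\<mu>: "sets \<mu> = sets ?T" and distr_\<mu>: "distr \<mu> (seq_algebra k) fst = \<PP>"
    using \<mu> by (auto simp: measures_over_def)
  interpret mu: prob_space \<mu> using \<mu> by (simp add: measures_over_def)
  have space_\<mu>: "space \<mu> = Seqs k \<times> M"
    using sets_eq_imp_space_eq[OF sets_\<mu>] by (simp add: space_total_algebra)
  have fst_meas: "fst \<in> measurable \<mu> \<PP>"
    using measurable_fst_total[of k M] measurable_cong_sets[OF sets_\<mu> sets_PP] by blast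
  have distr: "distr \<mu> \<PP> fst = \<PP>"
    using distr_\<mu> distr_cong[OF refl sets_PP, of \<mu> fst fst] by simp
  obtain B where B: "\<And>z. z \<in> Seqs k \<times> M \<Longrightarrow> \<bar>\<phi> z\<bar> \<le> B" using Lip1_bounded[OF \<phi>] by blast
  have \<phi>_meas: "\<phi> \<in> borel_measurable ?T" by (rule Lip1_measurable[OF \<phi>])
  \<comment> \<open>The integrand is set to zero on the null set where the coding map is undefined.\<close>
  define \<psi> where "\<psi> \<theta> = indicator ?S \<theta> * \<phi> (coding_hat M f \<theta>)" for \<theta>
  have \<psi>_meas: "\<psi> \<in> borel_measurable \<PP>"
  proof -
    have "(\<lambda>\<theta>. \<phi> (coding_hat M f \<theta>)) \<in> borel_measurable (restrict_space \<PP> ?S)"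
      by (rule measurable_compose[OF measurable_coding_hat \<phi>_meas])
    then show ?thesis unfolding \<psi>_def
      using borel_measurable_restrict_space_iff[of ?S \<PP> "\<lambda>\<theta>. \<phi> (coding_hat M f \<theta>)"] S_F_measurable
      by (simp add: sets.Int_space_eq2 mult.commute)
  qed
  have hat_in: "coding_hat M f \<theta> \<in> Seqs k \<times> M" if "\<theta> \<in> ?S" for \<theta>
    using that coding_in_M by (auto simp: coding_hat_def S_F_def)
  have \<psi>_bound: "\<bar>\<psi> \<theta>\<bar> \<le> \<bar>B\<bar>" for \<theta>
    using B[OF hat_in, of \<theta>] by (auto simp: \<psi>_def indicator_def)
  have skew_meas: "(skew f ^^ n) \<in> measurable \<mu> ?T"
    using measurable_funpow_skew measurable_cong_sets[OF sets_\<mu> refl] by blast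
  have shift_meas: "(\<lambda>z. (shift ^^ n) (fst z)) \<in> measurable \<mu> \<PP>"
    by (rule measurable_compose[OF fst_meas measurable_funpow_shift])
  have left: "integral\<^sup>L ((skew_push k M f ^^ n) \<mu>) \<phi> = (LINT z|\<mu>. \<phi> ((skew f ^^ n) z))"
    unfolding funpow_skew_push[OF sets_\<mu>] by (rule integral_distr[OF skew_meas \<phi>_meas])
  have "integral\<^sup>L (coding_push k M f \<PP>) \<phi> = (LINT \<theta>|restrict_space \<PP> ?S. \<phi> (coding_hat M f \<theta>))"
    unfolding coding_push_def by (rule integral_distr[OF measurable_coding_hat \<phi>_meas])
  also have "\<dots> = (LINT \<theta>|\<PP>. \<psi> \<theta>)"
    unfolding \<psi>_def using S_F_measurable
    by (subst integral_restrict_space) (auto simp: sets.Int_space_eq2)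
  also have "\<dots> = (LINT \<theta>|\<PP>. \<psi> ((shift ^^ n) \<theta>))"
    by (rule integral_funpow_shift[OF \<psi>_meas, symmetric])
  also have "\<dots> = (LINT z|\<mu>. \<psi> ((shift ^^ n) (fst z)))"
    using integral_distr[OF fst_meas measurable_compose[OF measurable_funpow_shift \<psi>_meas]]
    by (simp only: distr)
  finally have right: "integral\<^sup>L (coding_push k M f \<PP>) \<phi> = (LINT z|\<mu>. \<psi> ((shift ^^ n) (fst z)))" .
  have int1: "integrable \<mu> (\<lambda>z. \<phi> ((skew f ^^ n) z))"
    using measurable_space[OF skew_meas] B
    by (intro mu.integrable_const_bound[where B = B] AE_I2 measurable_compose[OF skew_meas \<phi>_meas])
      (auto simp: space_total_algebra)
  have int2: "integrable \<mu> (\<lambda>z. \<psi> ((shift ^^ n) (fst z)))"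
    using \<psi>_bound
    by (intro mu.integrable_const_bound[where B = "\<bar>B\<bar>"] AE_I2 measurable_compose[OF shift_meas \<psi>_meas])
      auto
  have w: "(\<lambda>\<theta>. width (past ((shift ^^ n) \<theta>) n)) \<in> borel_measurable \<PP>"
    using integrable_width_shift[of n n] by auto
  have int3: "integrable \<mu> (\<lambda>z. width (past ((shift ^^ n) (fst z)) n))"
  proof (rule integrable_distr[OF fst_meas])
    show "integrable (distr \<mu> \<PP> fst) (\<lambda>\<theta>. width (past ((shift ^^ n) \<theta>) n))"
      unfolding distr by (rule integrable_width_shift)
  qed
  have "AE \<theta> in distr \<mu> \<PP> fst. (shift ^^ n) \<theta> \<in> ?S"
    unfolding distr by (rule AE_funpow_shift[OF AE_S_F])
  then have ae: "AE z in \<mu>. (shift ^^ n) (fst z) \<in> ?S" by (rule AE_distrD[OF fst_meas])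
  have "\<bar>(LINT z|\<mu>. \<phi> ((skew f ^^ n) z)) - (LINT z|\<mu>. \<psi> ((shift ^^ n) (fst z)))\<bar>
      = \<bar>LINT z|\<mu>. \<phi> ((skew f ^^ n) z) - \<psi> ((shift ^^ n) (fst z))\<bar>"
    using int1 int2 by simp
  also have "\<dots> \<le> (LINT z|\<mu>. \<bar>\<phi> ((skew f ^^ n) z) - \<psi> ((shift ^^ n) (fst z))\<bar>)"
    by (rule integral_abs_bound)
  also have "\<dots> \<le> (LINT z|\<mu>. width (past ((shift ^^ n) (fst z)) n))"
  proof (rule integral_mono_AE)
    show "AE z in \<mu>. \<bar>\<phi> ((skew f ^^ n) z) - \<psi> ((shift ^^ n) (fst z))\<bar>
        \<le> width (past ((shift ^^ n) (fst z)) n)"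
      using ae AE_space
    proof eventually_elim
      case (elim z)
      obtain \<theta> x where z: "z = (\<theta>, x)" by fastforce
      have in_T: "(skew f ^^ n) z \<in> Seqs k \<times> M"
        using measurable_space[OF skew_meas] elim by (simp add: space_total_algebra)
      have S: "(shift ^^ n) \<theta> \<in> ?S" using elim by (simp add: z)
      have "\<bar>\<phi> ((skew f ^^ n) z) - \<phi> (coding_hat M f ((shift ^^ n) \<theta>))\<bar>
          \<le> dprod ((skew f ^^ n) z) (coding_hat M f ((shift ^^ n) \<theta>))"
        by (rule Lip1D[OF \<phi> in_T hat_in[OF S]])
      then have "\<bar>\<phi> ((skew f ^^ n) z) - \<psi> ((shift ^^ n) \<theta>)\<bar>
          \<le> dprod ((skew f ^^ n) z) (coding_hat M f ((shift ^^ n) \<theta>))"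
        using S by (simp add: \<psi>_def)
      also have "\<dots> \<le> width (past ((shift ^^ n) \<theta>) n)"
        using dprod_skew_coding_le[of \<theta> n x] elim by (simp add: z space_\<mu>)
      finally show ?case by (simp add: z)
    qed
  qed (use int1 int2 int3 in auto)
  also have "\<dots> = expectation (\<lambda>\<theta>. width (past ((shift ^^ n) \<theta>) n))"
    using integral_distr[OF fst_meas w] by (simp only: distr)
  also have "\<dots> = expectation (\<lambda>\<theta>. width (past \<theta> n))" by (rule expectation_width_shift)
  finally show ?thesis unfolding left right .
qed

lemma wasserstein_le_expected_width:
  assumes "\<mu> \<in> measures_over k M \<PP>"
  shows "wasserstein k M ((skew_push k M f ^^ n) \<mu>) (coding_push k M f \<PP>)
    \<le> expectation (\<lambda>\<theta>. width (past \<theta> n))"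
  unfolding wasserstein_def
proof (rule cSUP_least)
  have "(\<lambda>_. 0) \<in> Lip1 k M"
    by (auto simp: Lip1_def dprod_def d1_def d0_nonneg intro!: add_nonneg_nonneg sum_nonneg)
  then show "Lip1 k M \<noteq> {}" by blast
qed (rule integral_diff_le_expected_width[OF assms])

lemma S_F_full_measure: "prob (S_F k M f) = 1"
  using AE_S_F S_F_measurable by (simp add: prob_eq_1)

text \<open>One factor \<open>q ^ n\<close> of the mean width absorbs the constant
  \<open>C\<close> for large \<open>n\<close>.\<close>

lemma wasserstein_contraction:
  "\<exists>r::real. 0 < r \<and> r < 1 \<and> (\<exists>N::nat. \<forall>\<mu>\<in>measures_over k M \<PP>. \<forall>n\<ge>N.
     wasserstein k M ((skew_push k M f ^^ n) \<mu>) (coding_push k M f \<PP>) \<le> real CARD('m) * r ^ n)"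
proof (rule expected_width_decay)
  fix C q :: real
  assume q: "0 < q" "q < 1" and E: "\<And>n. expectation (\<lambda>\<theta>. width (past \<theta> n)) \<le> C * (q ^ n)\<^sup>2"
  have "(\<lambda>n. C * q ^ n) \<longlonglongrightarrow> C * 0" using q by (intro tendsto_intros LIMSEQ_power_zero) simp
  then have "\<forall>\<^sub>F n in sequentially. C * q ^ n < 1" by (rule order_tendstoD) simp
  then obtain N where N: "\<And>n. n \<ge> N \<Longrightarrow> C * q ^ n < 1" by (auto simp: eventually_sequentially)
  have "wasserstein k M ((skew_push k M f ^^ n) \<mu>) (coding_push k M f \<PP>) \<le> real CARD('m) * q ^ n"
    if "\<mu> \<in> measures_over k M \<PP>" "n \<ge> N" for \<mu> n
  proof -
    have "wasserstein k M ((skew_push k M f ^^ n) \<mu>) (coding_push k M f \<PP>) \<le> C * q ^ n * q ^ n"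
      using wasserstein_le_expected_width[OF that(1), of n] E[of n] by (simp add: power2_eq_square)
    also have "\<dots> \<le> real CARD('m) * q ^ n"
    proof (rule mult_right_mono)
      have "0 < CARD('m)" by simp
      then have "1 \<le> real CARD('m)" by linarith
      then show "C * q ^ n \<le> real CARD('m)" using N[OF that(2)] by linarith
    qed (use q in simp)
    finally show ?thesis .
  qed
  then show ?thesis using q by blast
qed

text \<open>The random constant takes care of the finitely many times at which the almost sure
  bound does not hold yet, so the estimate holds from time zero on.\<close>

lemma AE_synchronization:
  "\<exists>q::real. 0 < q \<and> q < 1 \<and> (\<exists>N::nat. AE \<theta> in \<PP>. \<exists>C>0. \<forall>n\<ge>N. \<forall>x\<in>M.
     dprod ((skew f ^^ n) (\<theta>, x)) (coding_hat M f ((shift ^^ n) \<theta>)) \<le> C * q ^ n)"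
proof (rule expected_width_decay)
  fix C q :: real
  assume q: "0 < q" "q < 1" and "\<And>n. expectation (\<lambda>\<theta>. width (past \<theta> n)) \<le> C * (q ^ n)\<^sup>2"
  then have ev: "AE \<theta> in \<PP>. \<forall>\<^sub>F n in sequentially. width (past ((shift ^^ n) \<theta>) n) \<le> q ^ n"
    by (rule AE_width_decay)
  have "AE \<theta> in \<PP>. \<forall>n. (shift ^^ n) \<theta> \<in> S_F k M f"
    unfolding AE_all_countable by (intro allI AE_funpow_shift AE_S_F)
  with ev AE_space have "AE \<theta> in \<PP>. \<exists>C>0. \<forall>n\<ge>0. \<forall>x\<in>M.
     dprod ((skew f ^^ n) (\<theta>, x)) (coding_hat M f ((shift ^^ n) \<theta>)) \<le> C * q ^ n"
  proof eventually_elim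
    case (elim \<theta>)
    let ?w = "\<lambda>n. width (past ((shift ^^ n) \<theta>) n)"
    obtain N where N: "\<And>n. n \<ge> N \<Longrightarrow> ?w n \<le> q ^ n"
      using elim by (auto simp: eventually_sequentially)
    define C where "C = 1 + (\<Sum>n<N. ?w n / q ^ n)"
    have sum0: "0 \<le> (\<Sum>n<N. ?w n / q ^ n)"
      using q by (intro sum_nonneg) (auto simp: width_nonneg)
    have "?w n \<le> C * q ^ n" for n
    proof (cases "n < N")
      case True
      have "?w n / q ^ n \<le> (\<Sum>n<N. ?w n / q ^ n)"
        using True q by (intro member_le_sum) (auto simp: width_nonneg)
      then show ?thesis using q by (simp add: C_def pos_divide_le_eq[symmetric])
    next
      case False
      have "1 * q ^ n \<le> C * q ^ n" using q sum0 by (intro mult_right_mono) (auto simp: C_def)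
      then show ?thesis using N[of n] False by simp
    qed
    moreover have "0 < C" using sum0 by (simp add: C_def)
    moreover have "dprod ((skew f ^^ n) (\<theta>, x)) (coding_hat M f ((shift ^^ n) \<theta>)) \<le> ?w n"
      if "x \<in> M" for n x
      using that elim by (intro dprod_skew_coding_le) (auto simp: space_PP)
    ultimately show ?case by (meson order_trans)
  qed
  then show ?thesis using q by blast
qed

end

section \<open>Almost sure coding, contraction and synchronization\<close>

theorem theorem4:
  fixes k :: nat
    and M :: "(real ^ 'm) set"
    and f :: "nat \<Rightarrow> real ^ 'm \<Rightarrow> real ^ 'm"
    and P :: "nat \<Rightarrow> nat \<Rightarrow> real"
    and p :: "nat \<Rightarrow> real"
    and \<PP> :: "(int \<Rightarrow> nat) measure"
  assumes "compact M" and "M \<noteq> {}" and "connected M"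
    and "\<forall>i\<in>{1..k}. continuous_on M (f i) \<and> f i ` M \<subseteq> M"
    and "transition_matrix k P"
    and "stationary_vector k P p"
    and "markov_measure k P p \<PP>"
    and "irreducible_matrix k P"
    and "splits k P M f"
    and "\<exists>u\<in>{1..k}. \<forall>j\<in>{1..k}. 0 < P u j"
  shows
    "measure \<PP> (S_F k M f) = 1 \<and>
     (\<exists>r::real. 0 < r \<and> r < 1 \<and> (\<exists>N::nat. \<forall>\<mu>\<in>measures_over k M \<PP>. \<forall>n\<ge>N.
        wasserstein k M ((skew_push k M f ^^ n) \<mu>) (coding_push k M f \<PP>)
          \<le> real CARD('m) * r ^ n)) \<and>
     (\<exists>q::real. 0 < q \<and> q < 1 \<and> (\<exists>N::nat. AE \<theta> in \<PP>. \<exists>C>0. \<forall>n\<ge>N. \<forall>x\<in>M.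
        dprod ((skew f ^^ n) (\<theta>, x)) (coding_hat M f ((shift ^^ n) \<theta>)) \<le> C * q ^ n))"
proof -
  obtain u where u: "u \<in> {1..k}" "\<forall>j\<in>{1..k}. 0 < P u j" using assms(10) by blast
  interpret splitting_skew_product k P p M f u \<PP>
    by unfold_locales (fact assms u)+
  show ?thesis
    by (intro conjI S_F_full_measure wasserstein_contraction AE_synchronization)
qed

end
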